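(* For every positive integer $k$ there exists a finite soluble group $G$ such that $\alpha(G)-\mathrm{Mindim}(G)\geqslant k$.
   Context: Let $G$ be a finite group. A set $\mathcal{S}$ of maximal subgroups of $G$ is irredundant if the intersection of the subgroups in $\mathcal{S}$ is not equal to the intersection of any proper subset of $\mathcal{S}$ (the empty intersection being $G$). An irredundant set of maximal subgroups is maximal irredundant if it is not properly contained in any other irredundant set of maximal subgroups. $\mathrm{Mindim}(G)$ is the minimal size of a maximal irredundant set of maximal subgroups of $G$. Let $\mathcal{M}$ be the set of maximal subgroups of $G$ and $\mathrm{Frat}(G)$ the Frattini subgroup of $G$. Define $\alpha(G)=\min\{|\mathcal{T}| : \mathcal{T}\subseteq\mathcal{M},\ \bigcap_{H\in\mathcal{T}}H=\mathrm{Frat}(G)\}$. *)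

theory Defs
  imports "HOL-Algebra.Algebra"
begin

definition maximal_subgroup :: "'a set \<Rightarrow> ('a, 'b) monoid_scheme \<Rightarrow> bool" where
  "maximal_subgroup M G \<longleftrightarrow>
     subgroup M G \<and> M \<noteq> carrier G \<and>
     (\<forall>K. subgroup K G \<and> M \<subseteq> K \<longrightarrow> K = M \<or> K = carrier G)"

definition maximal_subgroups :: "('a, 'b) monoid_scheme \<Rightarrow> 'a set set" where
  "maximal_subgroups G = {M. maximal_subgroup M G}"

(* Intersecting with the carrier makes the empty intersection the whole group. *)
definition inter_in :: "('a, 'b) monoid_scheme \<Rightarrow> 'a set set \<Rightarrow> 'a set" where
  "inter_in G S = carrier G \<inter> \<Inter>S"

definition frattini :: "('a, 'b) monoid_scheme \<Rightarrow> 'a set" where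
  "frattini G = inter_in G (maximal_subgroups G)"

definition irredundant :: "('a, 'b) monoid_scheme \<Rightarrow> 'a set set \<Rightarrow> bool" where
  "irredundant G S \<longleftrightarrow>
     S \<subseteq> maximal_subgroups G \<and> (\<forall>T. T \<subset> S \<longrightarrow> inter_in G T \<noteq> inter_in G S)"

definition maximal_irredundant :: "('a, 'b) monoid_scheme \<Rightarrow> 'a set set \<Rightarrow> bool" where
  "maximal_irredundant G S \<longleftrightarrow>
     irredundant G S \<and> (\<forall>T. irredundant G T \<longrightarrow> \<not> S \<subset> T)"

(* Mindim and alpha are meant for finite groups only; there the minimum is attained
   (lemmas ex_maximal_irredundant and ex_inter_frattini). *)
definition Mindim :: "('a, 'b) monoid_scheme \<Rightarrow> nat" where
  "Mindim G = (LEAST n. \<exists>S. maximal_irredundant G S \<and> card S = n)"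

definition alpha :: "('a, 'b) monoid_scheme \<Rightarrow> nat" where
  "alpha G = (LEAST n. \<exists>T \<subseteq> maximal_subgroups G. inter_in G T = frattini G \<and> card T = n)"

lemma finite_maximal_subgroups:
  assumes "finite (carrier G)"
  shows "finite (maximal_subgroups G)"
proof (rule finite_subset)
  show "maximal_subgroups G \<subseteq> Pow (carrier G)"
    using subgroup.subset by (auto simp: maximal_subgroups_def maximal_subgroup_def)
qed (use assms in simp)

lemma ex_maximal_irredundant:
  assumes "finite (carrier G)"
  shows "\<exists>S. maximal_irredundant G S"
proof -
  have "finite {S. irredundant G S}"
    by (rule finite_subset[of _ "Pow (maximal_subgroups G)"])
       (use finite_maximal_subgroups[OF assms] in \<open>auto simp: irredundant_def\<close>)
  moreover have "{} \<in> {S. irredundant G S}"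
    by (simp add: irredundant_def)
  ultimately obtain S where "S \<in> {S. irredundant G S}"
      and "\<forall>T\<in>{S. irredundant G S}. S \<subseteq> T \<longrightarrow> S = T"
    using finite_has_maximal[of "{S. irredundant G S}"] by blast
  then show ?thesis
    unfolding maximal_irredundant_def by blast
qed

lemma ex_inter_frattini:
  "\<exists>T \<subseteq> maximal_subgroups G. inter_in G T = frattini G"
  by (auto simp: frattini_def)

end

theory Submission
  imports Defs "HOL-Library.Numeral_Type"
begin

text \<open>
The construction. Let \<open>A\<close> be the group of order 144 of all semilinear affine maps
\<open>z \<mapsto> u * z + b\<close> and \<open>z \<mapsto> u * frob z + b\<close> of the field with nine elements (\<open>frob\<close> is the
Frobenius map), and let \<open>B\<close> be its subgroup of index 2 in which \<open>u\<close> has norm 1. Two facts about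
the action on the nine points drive the proof: any two points are fixed by an involution, and
every element that fixes two points lies in \<open>B\<close>. The group \<open>grp n\<close> is the \<open>n\<close>-fold fibre power
of \<open>A\<close> over \<open>A/B\<close>: all coordinates lie in \<open>B\<close>, or none does.

Its maximal subgroups come in two kinds (\<open>maximal_missing_translation\<close>). One that misses a
translation in coordinate \<open>i\<close> is the stabiliser of a point in coordinate \<open>i\<close>. One that contains
all translations corresponds to a maximal subgroup of a 2-group; so it has index 2 and contains
the Frattini part \<open>core n\<close> of that 2-group (\<open>core_le_maximal\<close>, \<open>maximal_index_2\<close>), where all coordinates
are linear with \<open>u\<close> of norm 1.

Mindim is small. Take the stabilisers of 0 in all coordinates, the single subgroup \<open>norm_one n\<close>
of elements with all coordinates in \<open>B\<close>, and for each \<open>i\<close> the subgroup of elements that are linear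
(no Frobenius) in coordinate \<open>i\<close>: an irredundant family of \<open>2n + 1\<close> subgroups. A further point
stabiliser in any coordinate would, together with the stabiliser of 0, force membership in
\<open>norm_one n\<close> and make that subgroup redundant. A further subgroup of the second kind contains
\<open>core n\<close>, hence the intersection of the family. So the family is maximal irredundant
(\<open>maximal_irredundant_short\<close>), although its intersection is not trivial.

Alpha is large. The Frattini subgroup is trivial, so consider a family with trivial intersection.
Each coordinate needs at least two point stabilisers, for otherwise a point reflection
\<open>z \<mapsto> - z + b\<close> in that coordinate survives. If a coordinate has exactly two, then an involution
fixing the two points lies in all the stabilisers. The products of these involutions over sets
of such coordinates must be separated by the members of index 2, each of which halves at best;
so there are at least as many of those as there are coordinates with two stabilisers. Altogether
at least \<open>3n\<close> subgroups are needed (\<open>card_ge_3n\<close>). The difference of the two invariants is at least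
\<open>n - 1\<close>.
\<close>

section \<open>The field with nine elements\<close>

lemma mod3_cases: "x = 0 \<or> x = 1 \<or> x = (2 :: 3)"
proof -
  obtain z :: int where "x = of_int z" "0 \<le> z" "z < 3"
    by (cases x) auto
  then have "z = 0 \<or> z = 1 \<or> z = 2" by auto
  with \<open>x = of_int z\<close> show ?thesis by auto
qed

text \<open>The Gaussian integers modulo 3: \<open>F9 x y\<close> stands for \<open>x + y * iota\<close> with \<open>iota\<^sup>2 = - 1\<close>.\<close>

datatype F9 = F9 3 3

instantiation F9 :: comm_ring_1
begin
definition "0 = F9 0 0"
definition "1 = F9 1 0"
fun plus_F9 where "F9 x y + F9 x' y' = F9 (x + x') (y + y')"
fun minus_F9 where "F9 x y - F9 x' y' = F9 (x - x') (y - y')"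
fun uminus_F9 where "- F9 x y = F9 (- x) (- y)"
fun times_F9 where "F9 x y * F9 x' y' = F9 (x * x' - y * y') (x * y' + y * x')"
instance
proof
  fix a b c :: F9
  show "a * b * c = a * (b * c)" "a * b = b * a" "1 * a = a" "a + b + c = a + (b + c)"
    "a + b = b + a" "0 + a = a" "- a + a = 0" "a - b = a + - b"
    "(a + b) * c = a * c + b * c"
    by (cases a; cases b; cases c; simp add: zero_F9_def one_F9_def algebra_simps)+
  show "(0 :: F9) \<noteq> 1" by (simp add: zero_F9_def one_F9_def)
qed
end

text \<open>Cubing is the identity on the prime field and sends \<open>iota\<close> to \<open>- iota\<close>.\<close>

fun frob :: "F9 \<Rightarrow> F9" where "frob (F9 x y) = F9 x (- y)"

definition nrm :: "F9 \<Rightarrow> F9" where "nrm u = u * frob u"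

lemma frob_add [simp]: "frob (u + v) = frob u + frob v"
  by (cases u; cases v) simp

lemma frob_mult [simp]: "frob (u * v) = frob u * frob v"
  by (cases u; cases v) (simp add: algebra_simps)

lemma frob_frob [simp]: "frob (frob u) = u"
  by (cases u) simp

lemma frob_minus [simp]: "frob (- u) = - frob u"
  by (cases u) simp

lemma frob_0 [simp]: "frob 0 = 0" and frob_1 [simp]: "frob 1 = 1"
  by (simp_all add: zero_F9_def one_F9_def)

lemma nrm_mult [simp]: "nrm (u * v) = nrm u * nrm v"
  by (simp add: nrm_def mult_ac)

lemma nrm_frob [simp]: "nrm (frob u) = nrm u"
  by (simp add: nrm_def mult_ac)

lemma nrm_minus [simp]: "nrm (- u) = nrm u"
  by (simp add: nrm_def mult_ac)

lemma nrm_0 [simp]: "nrm 0 = 0" and nrm_1 [simp]: "nrm 1 = 1"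
  by (simp_all add: nrm_def)

lemma nrm_cases: "u = 0 \<or> nrm u = 1 \<or> nrm u = - 1"
proof -
  obtain x y where "u = F9 x y" by (cases u)
  with mod3_cases[of x] mod3_cases[of y] show ?thesis
    by (auto simp: nrm_def zero_F9_def one_F9_def)
qed

definition iota :: F9 where "iota = F9 0 1"

lemma nrm_eq_1_cases:
  assumes "nrm u = 1"
  shows "u \<in> {1, - 1, iota, - iota}"
proof -
  obtain x y where "u = F9 x y" by (cases u)
  with assms mod3_cases[of x] mod3_cases[of y] show ?thesis
    by (auto simp: nrm_def zero_F9_def one_F9_def iota_def)
qed

lemma char3: "a + a = - (a :: F9)"
proof -
  obtain x y where "a = F9 x y" by (cases a)
  with mod3_cases[of x] mod3_cases[of y] show ?thesis
    by auto
qed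

lemma minus_one_neq_one: "- 1 \<noteq> (1 :: F9)"
  by (simp add: one_F9_def)

lemma finite_F9: "finite (UNIV :: F9 set)"
proof (rule finite_subset)
  show "UNIV \<subseteq> (\<lambda>(x, y). F9 x y) ` UNIV"
  proof
    fix a :: F9 show "a \<in> (\<lambda>(x, y). F9 x y) ` UNIV" by (cases a) auto
  qed
qed simp

lemma nrm_square: "u \<noteq> 0 \<Longrightarrow> nrm u * nrm u = 1"
  using nrm_cases[of u] by auto

lemma nrm_eq_0_iff [simp]: "nrm u = 0 \<longleftrightarrow> u = 0"
  using nrm_square[of u] by fastforce

lemma nrm_nrm [simp]: "nrm (nrm u) = nrm u * nrm u"
  by (simp add: nrm_def mult_ac)

instantiation F9 :: field
begin
definition inverse_F9 :: "F9 \<Rightarrow> F9" where "inverse_F9 u = nrm u * frob u"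
definition "u div v = u * inverse (v :: F9)"
instance
proof
  fix u v :: F9
  show "u div v = u * inverse v" by (fact divide_F9_def)
  show "inverse (0 :: F9) = 0" by (simp add: inverse_F9_def)
  assume "u \<noteq> 0"
  from nrm_square[OF this] show "inverse u * u = 1"
    by (simp add: inverse_F9_def nrm_def mult_ac)
qed
end

lemma nrm_inverse: "u \<noteq> 0 \<Longrightarrow> nrm (inverse u) = nrm u"
  using nrm_square[of u] by (simp add: inverse_F9_def)

lemma frob_inverse [simp]: "frob (inverse u) = inverse (frob u)"
  by (simp add: inverse_F9_def nrm_def mult_ac)

lemma frob_eq_0_iff [simp]: "frob u = 0 \<longleftrightarrow> u = 0"
  by (metis frob_0 frob_frob)

lemma iota_simps [simp]: "frob iota = - iota" "iota * iota = - 1" "inverse iota = - iota" "nrm iota = 1"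
  by (simp_all add: iota_def inverse_F9_def nrm_def one_F9_def)

lemma one_plus_iota: "1 + iota \<noteq> 0" "(1 - iota) * inverse (1 + iota) = - iota"
  by (simp_all add: iota_def zero_F9_def one_F9_def inverse_F9_def nrm_def)

lemma nrm_one_plus_iota: "nrm (1 + iota) = - 1"
  by (simp add: iota_def one_F9_def nrm_def)

lemma minus_iota_neq_iota: "- iota \<noteq> iota"
  by (simp add: iota_def)

lemma frob_diff: "frob (u - v) = frob u - frob v"
  using frob_add[of u "- v"] by simp

section \<open>Semilinear affine maps and the fibre power\<close>

text \<open>\<open>Aff u s b\<close> encodes the map \<open>z \<mapsto> u * z + b\<close>, with \<open>frob z\<close> in place of \<open>z\<close> if \<open>s\<close> holds.
Triples instead of maps make the norm of \<open>u\<close> and the flag \<open>s\<close> directly accessible.\<close>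

datatype aff = Aff (lin: F9) (cj: bool) (tr: F9)

definition tw :: "bool \<Rightarrow> F9 \<Rightarrow> F9" where "tw s z = (if s then frob z else z)"

lemma tw_0 [simp]: "tw s 0 = 0" and tw_1 [simp]: "tw s 1 = 1"
  by (simp_all add: tw_def)

fun act :: "aff \<Rightarrow> F9 \<Rightarrow> F9" where "act (Aff u s b) z = u * tw s z + b"

definition aone :: aff where "aone = Aff 1 False 0"

fun amult :: "aff \<Rightarrow> aff \<Rightarrow> aff" (infixl "\<star>" 70) where
  "Aff u s b \<star> Aff v t d = Aff (u * tw s v) (s \<noteq> t) (u * tw s d + b)"

fun ainv :: "aff \<Rightarrow> aff" where
  "ainv (Aff u s b) = Aff (tw s (inverse u)) s (- tw s (inverse u * b))"

lemma amult_assoc: "x \<star> y \<star> z = x \<star> (y \<star> z)"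
  by (cases x; cases y; cases z) (simp add: tw_def algebra_simps)

lemma amult_aone [simp]: "aone \<star> x = x" "x \<star> aone = x"
  by (cases x; simp add: aone_def tw_def)+

lemma amult_ainv: "lin x \<noteq> 0 \<Longrightarrow> ainv x \<star> x = aone" "lin x \<noteq> 0 \<Longrightarrow> x \<star> ainv x = aone"
  by (cases x; simp add: aone_def tw_def algebra_simps)+

lemma act_amult [simp]: "act (x \<star> y) z = act x (act y z)"
  by (cases x; cases y) (simp add: tw_def algebra_simps)

lemma act_aone [simp]: "act aone z = z"
  by (simp add: aone_def tw_def)

lemma nrm_tw [simp]: "nrm (tw s u) = nrm u"
  by (simp add: tw_def)

lemma nrm_lin_amult [simp]: "nrm (lin (x \<star> y)) = nrm (lin x) * nrm (lin y)"
  by (cases x; cases y) simp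

lemma cj_amult [simp]: "cj (x \<star> y) = (cj x \<noteq> cj y)"
  by (cases x; cases y) simp

lemma nrm_lin_ainv [simp]: "lin x \<noteq> 0 \<Longrightarrow> nrm (lin (ainv x)) = nrm (lin x)"
  by (cases x) (simp add: nrm_inverse)

lemma cj_ainv [simp]: "cj (ainv x) = cj x"
  by (cases x) simp

lemma aone_sel [simp]: "lin aone = 1" "cj aone = False" "tr aone = 0"
  by (simp_all add: aone_def)

text \<open>The norm of the factor \<open>u\<close> takes the values 1 and -1 on semilinear maps, so a common value \<open>c\<close>
means that the coordinates agree modulo the index 2 subgroup of maps of norm 1. Coordinates from \<open>n\<close>
on are trivial, which makes the elements of the fibre power unique as functions.\<close>

definition grp :: "nat \<Rightarrow> (nat \<Rightarrow> aff) monoid" where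
  "grp n = \<lparr>carrier = {g. (\<exists>c. c \<noteq> 0 \<and> (\<forall>i<n. nrm (lin (g i)) = c)) \<and> (\<forall>i\<ge>n. g i = aone)},
            monoid.mult = (\<lambda>g h i. g i \<star> h i), one = (\<lambda>_. aone)\<rparr>"

lemma mult_grp [simp]: "(g \<otimes>\<^bsub>grp n\<^esub> h) i = g i \<star> h i"
  and one_grp [simp]: "\<one>\<^bsub>grp n\<^esub> i = aone"
  by (simp_all add: grp_def)

lemma grpI:
  assumes "\<And>i. i < n \<Longrightarrow> nrm (lin (g i)) = c" "c \<noteq> 0" "\<And>i. i \<ge> n \<Longrightarrow> g i = aone"
  shows "g \<in> carrier (grp n)"
  using assms by (auto simp: grp_def)

lemma grpE:
  assumes "g \<in> carrier (grp n)"
  obtains c where "\<And>i. i < n \<Longrightarrow> nrm (lin (g i)) = c" "c \<noteq> 0" "\<And>i. i \<ge> n \<Longrightarrow> g i = aone"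
  using assms by (auto simp: grp_def)

lemma grp_lin_nonzero: "g \<in> carrier (grp n) \<Longrightarrow> lin (g i) \<noteq> 0"
  by (cases "i < n") (auto simp: grp_def)

lemma grp_nrm_eq: "g \<in> carrier (grp n) \<Longrightarrow> i < n \<Longrightarrow> j < n \<Longrightarrow> nrm (lin (g i)) = nrm (lin (g j))"
  by (auto simp: grp_def)

lemma group_grp: "group (grp n)"
proof (rule groupI)
  fix x y assume x: "x \<in> carrier (grp n)" and y: "y \<in> carrier (grp n)"
  show "x \<otimes>\<^bsub>grp n\<^esub> y \<in> carrier (grp n)"
  proof -
    obtain c where c: "\<And>i. i < n \<Longrightarrow> nrm (lin (x i)) = c" "c \<noteq> 0" "\<And>i. i \<ge> n \<Longrightarrow> x i = aone"
      using x by (rule grpE) blast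
    obtain d where d: "\<And>i. i < n \<Longrightarrow> nrm (lin (y i)) = d" "d \<noteq> 0" "\<And>i. i \<ge> n \<Longrightarrow> y i = aone"
      using y by (rule grpE) blast
    show ?thesis by (rule grpI[of _ _ "c * d"]) (simp_all add: c d)
  qed
next
  show "\<one>\<^bsub>grp n\<^esub> \<in> carrier (grp n)"
    by (rule grpI[of _ _ 1]) auto
next
  fix x y z
  show "x \<otimes>\<^bsub>grp n\<^esub> y \<otimes>\<^bsub>grp n\<^esub> z = x \<otimes>\<^bsub>grp n\<^esub> (y \<otimes>\<^bsub>grp n\<^esub> z)"
    by (rule ext) (simp add: amult_assoc)
  show "\<one>\<^bsub>grp n\<^esub> \<otimes>\<^bsub>grp n\<^esub> x = x"
    by (rule ext) simp
next
  fix x assume x: "x \<in> carrier (grp n)"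
  obtain c where c: "\<And>i. i < n \<Longrightarrow> nrm (lin (x i)) = c" "c \<noteq> 0" "\<And>i. i \<ge> n \<Longrightarrow> x i = aone"
    using x by (rule grpE) blast
  show "\<exists>y\<in>carrier (grp n). y \<otimes>\<^bsub>grp n\<^esub> x = \<one>\<^bsub>grp n\<^esub>"
  proof (rule bexI[of _ "\<lambda>i. ainv (x i)"])
    show "(\<lambda>i. ainv (x i)) \<in> carrier (grp n)"
      by (rule grpI[of _ _ c])
        (use c grp_lin_nonzero[OF x] in \<open>auto simp: aone_def tw_def\<close>)
    show "(\<lambda>i. ainv (x i)) \<otimes>\<^bsub>grp n\<^esub> x = \<one>\<^bsub>grp n\<^esub>"
      using grp_lin_nonzero[OF x] by (intro ext) (simp add: amult_ainv)
  qed
qed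

interpretation grp: group "grp n" for n
  by (rule group_grp)

lemma inv_grp [simp]:
  assumes "g \<in> carrier (grp n)"
  shows "(inv\<^bsub>grp n\<^esub> g) i = ainv (g i)"
proof -
  have "(g \<otimes>\<^bsub>grp n\<^esub> inv\<^bsub>grp n\<^esub> g) i = aone"
    using assms by simp
  then have "g i \<star> (inv\<^bsub>grp n\<^esub> g) i = aone" by (simp only: mult_grp)
  then have "ainv (g i) \<star> (g i \<star> (inv\<^bsub>grp n\<^esub> g) i) = ainv (g i)" by simp
  then show ?thesis
    by (simp add: amult_assoc[symmetric] amult_ainv grp_lin_nonzero[OF assms])
qed

lemma finite_grp: "finite (carrier (grp n))"
proof (rule finite_subset)
  have "UNIV = (\<lambda>(u, s, b). Aff u s b) ` UNIV"
    by (rule sym, rule surjI[of _ "\<lambda>x. (lin x, cj x, tr x)"]) simp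
  moreover have "finite (UNIV :: (F9 \<times> bool \<times> F9) set)"
    using finite_F9 by (simp add: finite_Prod_UNIV)
  then have "finite ((\<lambda>(u, s, b). Aff u s b) ` UNIV)" by (rule finite_imageI)
  ultimately have "finite (UNIV :: aff set)" by simp
  then have "finite ((\<lambda>xs i. if i < n then xs ! i else aone) ` {xs :: aff list. set xs \<subseteq> UNIV \<and> length xs = n})"
    by (intro finite_imageI finite_lists_length_eq)
  then show "finite ((\<lambda>xs i. if i < n then xs ! i else aone) ` {xs :: aff list. length xs = n})"
    by simp
  show "carrier (grp n) \<subseteq> (\<lambda>xs i. if i < n then xs ! i else aone) ` {xs. length xs = n}"
  proof
    fix g assume g: "g \<in> carrier (grp n)"
    have "g = (\<lambda>i. if i < n then map g [0..<n] ! i else aone)"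
    proof
      fix i show "g i = (if i < n then map g [0..<n] ! i else aone)"
        using g by (simp add: grp_def)
    qed
    then show "g \<in> (\<lambda>xs i. if i < n then xs ! i else aone) ` {xs. length xs = n}"
      by (rule image_eqI) simp
  qed
qed

definition single :: "nat \<Rightarrow> aff \<Rightarrow> nat \<Rightarrow> aff" where
  "single i x = (\<lambda>j. if j = i then x else aone)"

lemma single_in_grp: "i < n \<Longrightarrow> nrm (lin x) = 1 \<Longrightarrow> single i x \<in> carrier (grp n)"
  by (rule grpI[of _ _ 1]) (auto simp: single_def)

definition diagonal :: "nat \<Rightarrow> aff \<Rightarrow> nat \<Rightarrow> aff" where
  "diagonal n x = (\<lambda>j. if j < n then x else aone)"

lemma diagonal_in_grp: "lin x \<noteq> 0 \<Longrightarrow> diagonal n x \<in> carrier (grp n)"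
  by (rule grpI[of _ _ "nrm (lin x)"]) (auto simp: diagonal_def)

section \<open>Maximal subgroups and irredundant families\<close>

lemma (in group) cancel_left:
  assumes "x \<in> carrier G" "y \<in> carrier G"
  shows "x \<otimes> (inv x \<otimes> y) = y" "inv x \<otimes> (x \<otimes> y) = y"
  using assms by (simp_all add: m_assoc[symmetric])

lemma (in group) maximal_subgroup_if_index_2:
  assumes "subgroup M G" "M \<noteq> carrier G"
    and "\<And>x y. x \<in> carrier G - M \<Longrightarrow> y \<in> carrier G - M \<Longrightarrow> x \<otimes> y \<in> M"
  shows "maximal_subgroup M G"
  unfolding maximal_subgroup_def
proof (intro conjI allI impI)
  fix K assume K: "subgroup K G \<and> M \<subseteq> K"
  then interpret K: subgroup K G by simp
  show "K = M \<or> K = carrier G"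
  proof (rule disjCI)
    assume "K \<noteq> carrier G"
    then obtain y where y: "y \<in> carrier G" "y \<notin> K" using K.subset by blast
    have "K \<subseteq> M"
    proof
      fix x assume "x \<in> K"
      show "x \<in> M"
      proof (rule ccontr)
        assume "x \<notin> M"
        then have "x \<otimes> y \<in> K" using assms(3)[of x y] y \<open>x \<in> K\<close> K by auto
        then have "inv x \<otimes> (x \<otimes> y) \<in> K"
          using \<open>x \<in> K\<close> K.m_closed K.m_inv_closed by simp
        with y \<open>x \<in> K\<close> show False by (simp add: cancel_left)
      qed
    qed
    with K show "K = M" by blast
  qed
qed (use assms in auto)

lemma (in group) maximal_subgroup_eqI:
  assumes "maximal_subgroup L G" "subgroup Y G" "L \<subseteq> Y" "y \<in> Y" "y \<notin> L"
  shows "Y = carrier G"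
  using assms unfolding maximal_subgroup_def by blast

text \<open>A step up the upper central series, in the way one proves that maximal subgroups of nilpotent groups
contain all commutators. If \<open>c\<close> were outside \<open>L\<close>, then \<open>L\<close> and \<open>c\<close> would generate the group. As all
commutators with \<open>c\<close> lie in \<open>L\<close>, the element \<open>c\<close> normalises \<open>L\<close>, so \<open>L\<close> is normal; then \<open>c\<close> is central
modulo \<open>L\<close>, so the quotient is abelian and the commutator \<open>c\<close> lies in \<open>L\<close> after all.\<close>

lemma (in group) commutator_in_maximal_subgroup:
  assumes L: "maximal_subgroup L G" and p: "p \<in> carrier G" and q: "q \<in> carrier G"
    and c: "c = p \<otimes> q \<otimes> inv p \<otimes> inv q"
    and central: "\<And>g. g \<in> carrier G \<Longrightarrow> c \<otimes> g \<otimes> inv c \<otimes> inv g \<in> L"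
  shows "c \<in> L"
proof (rule ccontr)
  assume "c \<notin> L"
  interpret L: subgroup L G using L by (simp add: maximal_subgroup_def)
  have cG: "c \<in> carrier G" using c p q by simp
  \<comment> \<open>the normaliser of \<open>L\<close>\<close>
  define N where "N = {g \<in> carrier G. \<forall>x. x \<in> carrier G \<longrightarrow> (g \<otimes> x \<otimes> inv g \<in> L \<longleftrightarrow> x \<in> L)}"
  have "subgroup N G"
  proof (rule subgroupI)
    show "N \<noteq> {}" using one_closed by (auto simp: N_def)
    fix g assume g: "g \<in> N"
    have "inv g \<otimes> x \<otimes> g \<in> L \<longleftrightarrow> x \<in> L" if x: "x \<in> carrier G" for x
    proof -
      have "g \<otimes> (inv g \<otimes> x \<otimes> g) \<otimes> inv g = x"
        using g x by (simp add: N_def m_assoc cancel_left)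
      moreover have "g \<otimes> (inv g \<otimes> x \<otimes> g) \<otimes> inv g \<in> L \<longleftrightarrow> inv g \<otimes> x \<otimes> g \<in> L"
        using g x by (simp add: N_def)
      ultimately show ?thesis by simp
    qed
    then show "inv g \<in> N" using g by (auto simp: N_def)
    fix h assume h: "h \<in> N"
    have "(g \<otimes> h) \<otimes> x \<otimes> inv (g \<otimes> h) = g \<otimes> (h \<otimes> x \<otimes> inv h) \<otimes> inv g" if "x \<in> carrier G" for x
      using that g h by (simp add: N_def m_assoc inv_mult_group)
    then show "g \<otimes> h \<in> N" using g h by (auto simp: N_def)
  qed (auto simp: N_def)
  moreover have "L \<subseteq> N"
  proof
    fix g assume g: "g \<in> L"
    have rev_incl: "x \<in> L" if "x \<in> carrier G" "g \<otimes> x \<otimes> inv g \<in> L" for x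
    proof -
      have "inv g \<otimes> (g \<otimes> x \<otimes> inv g) \<otimes> g \<in> L"
        by (rule L.m_closed[OF L.m_closed[OF L.m_inv_closed[OF g] that(2)] g])
      moreover have "inv g \<otimes> (g \<otimes> x \<otimes> inv g) \<otimes> g = x"
        using g that by (simp add: m_assoc cancel_left)
      ultimately show ?thesis by simp
    qed
    have "g \<otimes> x \<otimes> inv g \<in> L \<longleftrightarrow> x \<in> L" if x: "x \<in> carrier G" for x
    proof
      assume "x \<in> L"
      then show "g \<otimes> x \<otimes> inv g \<in> L"
        by (rule L.m_closed[OF L.m_closed[OF g] L.m_inv_closed[OF g]])
    qed (rule rev_incl[OF x])
    then show "g \<in> N" using L.mem_carrier[OF g] unfolding N_def by simp
  qed
  moreover have "c \<in> N"
  proof -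
    have "c \<otimes> x \<otimes> inv c \<in> L \<longleftrightarrow> x \<in> L" if x: "x \<in> carrier G" for x
    proof
      assume "x \<in> L"
      then have "c \<otimes> x \<otimes> inv c \<otimes> inv x \<otimes> x \<in> L"
        by (intro L.m_closed central[OF x])
      then show "c \<otimes> x \<otimes> inv c \<in> L" using cG x by (simp add: m_assoc)
    next
      assume *: "c \<otimes> x \<otimes> inv c \<in> L"
      have "inv (c \<otimes> x \<otimes> inv c \<otimes> inv x) \<otimes> (c \<otimes> x \<otimes> inv c) \<in> L"
        by (intro L.m_closed L.m_inv_closed central[OF x] *)
      moreover have "inv (c \<otimes> x \<otimes> inv c \<otimes> inv x) \<otimes> (c \<otimes> x \<otimes> inv c) = x"
        using cG x by (simp add: m_assoc inv_mult_group cancel_left)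
      ultimately show "x \<in> L" by simp
    qed
    then show ?thesis using cG by (auto simp: N_def)
  qed
  ultimately have "N = carrier G"
    using maximal_subgroup_eqI[OF L _ _ _ \<open>c \<notin> L\<close>] by blast
  then have normal: "g \<otimes> x \<otimes> inv g \<in> L" if "g \<in> carrier G" "x \<in> L" for g x
    using that L.subset unfolding N_def by blast
  \<comment> \<open>the preimage of the centre of the quotient by \<open>L\<close>\<close>
  define Z where "Z = {g \<in> carrier G. \<forall>h\<in>carrier G. g \<otimes> h \<otimes> inv g \<otimes> inv h \<in> L}"
  have "subgroup Z G"
  proof (rule subgroupI)
    show "Z \<noteq> {}" using one_closed by (auto simp: Z_def)
    fix g assume g: "g \<in> Z"
    have "inv g \<otimes> h \<otimes> inv (inv g) \<otimes> inv h \<in> L" if h: "h \<in> carrier G" for h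
    proof -
      have "inv g \<otimes> inv (g \<otimes> h \<otimes> inv g \<otimes> inv h) \<otimes> inv (inv g) \<in> L"
        using g h by (intro normal) (auto simp: Z_def)
      then show ?thesis using g h by (simp add: Z_def m_assoc inv_mult_group cancel_left)
    qed
    then show "inv g \<in> Z" using g by (auto simp: Z_def)
    fix k assume k: "k \<in> Z"
    have "(g \<otimes> k) \<otimes> h \<otimes> inv (g \<otimes> k) \<otimes> inv h \<in> L" if h: "h \<in> carrier G" for h
    proof -
      have "(g \<otimes> (k \<otimes> h \<otimes> inv k \<otimes> inv h) \<otimes> inv g) \<otimes> (g \<otimes> h \<otimes> inv g \<otimes> inv h) \<in> L"
        using g k h by - (rule L.m_closed[OF normal], auto simp: Z_def)
      then show ?thesis using g k h by (simp add: Z_def m_assoc inv_mult_group cancel_left)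
    qed
    then show "g \<otimes> k \<in> Z" using g k by (auto simp: Z_def)
  qed (auto simp: Z_def)
  moreover have "L \<subseteq> Z"
  proof
    fix g assume g: "g \<in> L"
    have "g \<otimes> h \<otimes> inv g \<otimes> inv h \<in> L" if h: "h \<in> carrier G" for h
    proof -
      have "g \<otimes> (h \<otimes> inv g \<otimes> inv h) \<in> L" by (rule L.m_closed[OF g normal[OF h L.m_inv_closed[OF g]]])
      then show ?thesis using g h by (simp add: m_assoc)
    qed
    then show "g \<in> Z" using g by (auto simp: Z_def)
  qed
  moreover have "c \<in> Z" using central cG by (auto simp: Z_def)
  ultimately have "Z = carrier G"
    using maximal_subgroup_eqI[OF L _ _ _ \<open>c \<notin> L\<close>] by blast
  then have "p \<in> Z" using p by simp
  then have "c \<in> L" using q by (simp add: c Z_def)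
  with \<open>c \<notin> L\<close> show False by simp
qed

lemma irredundantI:
  assumes "S \<subseteq> maximal_subgroups G"
    and "\<And>A. A \<in> S \<Longrightarrow> \<exists>g\<in>carrier G. g \<notin> A \<and> (\<forall>B\<in>S. B \<noteq> A \<longrightarrow> g \<in> B)"
  shows "irredundant G S"
  unfolding irredundant_def
proof (intro conjI allI impI assms)
  fix T assume "T \<subset> S"
  then obtain A where A: "A \<in> S" "A \<notin> T" "T \<subseteq> S" by blast
  then obtain g where g: "g \<in> carrier G" "g \<notin> A" "\<forall>B\<in>S. B \<noteq> A \<longrightarrow> g \<in> B" using assms(2) by blast
  with A have "g \<in> inter_in G T" "g \<notin> inter_in G S" by (auto simp: inter_in_def)
  then show "inter_in G T \<noteq> inter_in G S" by blast
qed

lemma redundantI: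
  assumes "A \<in> T" "carrier G \<inter> \<Inter> (T - {A}) \<subseteq> A"
  shows "\<not> irredundant G T"
proof -
  have "T - {A} \<subset> T" "inter_in G (T - {A}) = inter_in G T"
    using assms by (auto simp: inter_in_def)
  then show ?thesis unfolding irredundant_def by blast
qed

section \<open>Point stabilisers\<close>

definition stab :: "nat \<Rightarrow> nat \<Rightarrow> F9 \<Rightarrow> (nat \<Rightarrow> aff) set" where
  "stab n i z = {g \<in> carrier (grp n). act (g i) z = z}"

definition transl :: "nat \<Rightarrow> F9 \<Rightarrow> nat \<Rightarrow> aff" where
  "transl i b = single i (Aff 1 False b)"

text \<open>The preimage of the Frattini subgroup of the 2-group of linear parts: the commutators and
squares of semilinear maps are linear of norm 1.\<close>

definition core :: "nat \<Rightarrow> (nat \<Rightarrow> aff) set" where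
  "core n = {g \<in> carrier (grp n). \<forall>i<n. nrm (lin (g i)) = 1 \<and> \<not> cj (g i)}"

lemma transl_in_grp [simp]: "i < n \<Longrightarrow> transl i b \<in> carrier (grp n)"
  unfolding transl_def by (rule single_in_grp) simp_all

lemma act_transl: "act (transl i b j) z = (if j = i then z + b else z)"
  by (simp add: transl_def single_def tw_def)

lemma grp_eqI:
  assumes "\<And>j. (g :: nat \<Rightarrow> aff) j = h j" shows "g = h"
  using assms by (rule ext)

lemma subgroup_stab: "subgroup (stab n i z) (grp n)"
proof (rule grp.subgroupI)
  show "stab n i z \<noteq> {}" using grp.one_closed[of n] by (auto simp: stab_def)
  fix g assume g: "g \<in> stab n i z"
  then have "act (ainv (g i) \<star> g i) z = act (ainv (g i)) z"
    by (simp add: stab_def)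
  moreover have "lin (g i) \<noteq> 0" using g grp_lin_nonzero by (auto simp: stab_def)
  ultimately show "inv\<^bsub>grp n\<^esub> g \<in> stab n i z" using g
    by (simp add: stab_def amult_ainv)
  fix h assume h: "h \<in> stab n i z"
  then show "g \<otimes>\<^bsub>grp n\<^esub> h \<in> stab n i z" using g by (simp add: stab_def)
qed (auto simp: stab_def)

lemma conj_transl:
  "g \<otimes>\<^bsub>grp n\<^esub> transl i d = transl i (lin (g i) * tw (cj (g i)) d) \<otimes>\<^bsub>grp n\<^esub> g"
proof (rule grp_eqI)
  fix j
  show "(g \<otimes>\<^bsub>grp n\<^esub> transl i d) j = (transl i (lin (g i) * tw (cj (g i)) d) \<otimes>\<^bsub>grp n\<^esub> g) j"
    by (cases "g j") (auto simp: transl_def single_def tw_def)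
qed

lemma transl_mult: "transl i b \<otimes>\<^bsub>grp n\<^esub> transl i d = transl i (b + d)"
  by (rule grp_eqI) (simp add: transl_def single_def tw_def add_ac)

text \<open>Conjugation by an element with linear factor \<open>u\<close> multiplies a translation by \<open>u\<close>, and every nonzero
field element is a multiple of every other: the translations in one coordinate form a minimal
normal subgroup.\<close>

lemma all_translations:
  assumes K: "subgroup K (grp n)" and i: "i < n" and d: "transl i d \<in> K" "d \<noteq> 0"
    and g: "\<And>u. u \<noteq> 0 \<Longrightarrow> \<exists>g\<in>K. lin (g i) = u \<and> \<not> cj (g i)"
  shows "transl i b \<in> K"
proof (cases "b = 0")
  case True
  interpret K: subgroup K "grp n" by (fact K)
  have "transl i 0 = \<one>\<^bsub>grp n\<^esub>"
    by (rule grp_eqI) (simp add: transl_def single_def aone_def)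
  then show ?thesis using True by simp
next
  case False
  interpret K: subgroup K "grp n" by (fact K)
  obtain g where g: "g \<in> K" "lin (g i) = b / d" "\<not> cj (g i)"
    using g[of "b / d"] False d by auto
  have "transl i b \<otimes>\<^bsub>grp n\<^esub> g = g \<otimes>\<^bsub>grp n\<^esub> transl i d"
    using g d by (simp add: conj_transl tw_def)
  then have "transl i b = g \<otimes>\<^bsub>grp n\<^esub> transl i d \<otimes>\<^bsub>grp n\<^esub> inv\<^bsub>grp n\<^esub> g"
    using g i by (simp add: grp.inv_solve_right)
  also have "\<dots> \<in> K" using g d by blast
  finally show ?thesis .
qed

text \<open>The action on coordinate \<open>i\<close> is primitive: an element that moves \<open>z\<close> differs by a translation from
one that fixes \<open>z\<close>, so a larger subgroup contains a nontrivial translation, then all translations,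
and the stabiliser together with these is the whole group.\<close>

lemma maximal_stab:
  assumes i: "i < n"
  shows "maximal_subgroup (stab n i z) (grp n)"
  unfolding maximal_subgroup_def
proof (intro conjI allI impI)
  have "transl i 1 \<notin> stab n i z" by (simp add: stab_def act_transl)
  then show "stab n i z \<noteq> carrier (grp n)" using i by (metis transl_in_grp)
  fix K assume K: "subgroup K (grp n) \<and> stab n i z \<subseteq> K"
  then interpret K: subgroup K "grp n" by simp
  show "K = stab n i z \<or> K = carrier (grp n)"
  proof (cases "K = stab n i z")
    case False
    then obtain y where y: "y \<in> K" "y \<notin> stab n i z" using K by blast
    define e where "e = act (y i) z - z"
    have e: "e \<noteq> 0" using y K.subset by (auto simp: e_def stab_def)
    have "transl i (- e) \<otimes>\<^bsub>grp n\<^esub> y \<in> stab n i z"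
      using y K.subset i by (auto simp: stab_def act_transl e_def)
    then have "transl i (- e) \<otimes>\<^bsub>grp n\<^esub> y \<otimes>\<^bsub>grp n\<^esub> inv\<^bsub>grp n\<^esub> y \<in> K"
      using y K by blast
    then have e': "transl i (- e) \<in> K" using y i by (simp add: grp.m_assoc)
    have *: "transl i b \<in> K" for b
    proof (rule all_translations[OF _ i e'])
      show "subgroup K (grp n)" by (rule K.is_subgroup)
      fix u :: F9 assume u: "u \<noteq> 0"
      have "diagonal n (Aff u False (z - u * z)) \<in> stab n i z"
        using i u by (simp add: stab_def diagonal_in_grp) (simp add: diagonal_def tw_def)
      then show "\<exists>g\<in>K. lin (g i) = u \<and> \<not> cj (g i)"
        using K i by (intro bexI[of _ "diagonal n (Aff u False (z - u * z))"]) (auto simp: diagonal_def)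
    qed (use e in simp)
    have "g \<in> K" if g: "g \<in> carrier (grp n)" for g
    proof -
      have "transl i (z - act (g i) z) \<otimes>\<^bsub>grp n\<^esub> g \<in> stab n i z"
        using g i by (simp add: stab_def act_transl)
      then have "inv\<^bsub>grp n\<^esub> (transl i (z - act (g i) z)) \<otimes>\<^bsub>grp n\<^esub> (transl i (z - act (g i) z) \<otimes>\<^bsub>grp n\<^esub> g) \<in> K"
        using K * by blast
      then show ?thesis using g i by (simp add: grp.cancel_left)
    qed
    then show ?thesis using K.subset by blast
  qed simp
qed (rule subgroup_stab)

text \<open>The translations in coordinate \<open>i\<close> form an abelian minimal normal subgroup, so \<open>M\<close> is a complement
to them. Hence \<open>M\<close> contains an element that is a point reflection \<open>z \<mapsto> - z + e\<close> in coordinate \<open>i\<close> and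
trivial elsewhere. Its commutator with any element of \<open>M\<close> is a translation in coordinate \<open>i\<close>, hence
trivial; so \<open>M\<close> fixes the centre \<open>- e\<close> of that reflection.\<close>

lemma maximal_missing_translation:
  assumes M: "maximal_subgroup M (grp n)" and i: "i < n" and b: "transl i b \<notin> M"
  shows "\<exists>z. M = stab n i z"
proof -
  interpret M: subgroup M "grp n" using M by (simp add: maximal_subgroup_def)
  \<comment> \<open>the product of \<open>M\<close> and the translations in coordinate \<open>i\<close>\<close>
  define Y where "Y = {g \<in> carrier (grp n). \<exists>b. transl i b \<otimes>\<^bsub>grp n\<^esub> g \<in> M}"
  have zero: "transl i 0 \<otimes>\<^bsub>grp n\<^esub> g = g" for g
    by (rule grp_eqI) (simp add: transl_def single_def aone_def[symmetric])
  have zero': "transl i 0 = \<one>\<^bsub>grp n\<^esub>"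
    by (rule grp_eqI) (simp add: transl_def single_def aone_def)
  have "subgroup Y (grp n)"
  proof (rule grp.subgroupI)
    show "Y \<noteq> {}" using M.one_closed zero unfolding Y_def
      by (metis (mono_tags, lifting) M.subset empty_iff mem_Collect_eq subsetD)
    fix g assume "g \<in> Y"
    then obtain b where g: "g \<in> carrier (grp n)" and b: "transl i b \<otimes>\<^bsub>grp n\<^esub> g \<in> M"
      by (auto simp: Y_def)
    define e where "e = lin ((inv\<^bsub>grp n\<^esub> g) i) * tw (cj ((inv\<^bsub>grp n\<^esub> g) i)) (- b)"
    have "transl i (- b) \<otimes>\<^bsub>grp n\<^esub> (transl i b \<otimes>\<^bsub>grp n\<^esub> g) = g"
      using g i by (simp add: grp.m_assoc[symmetric] transl_mult zero)
    then have "inv\<^bsub>grp n\<^esub> (transl i b \<otimes>\<^bsub>grp n\<^esub> g) = inv\<^bsub>grp n\<^esub> g \<otimes>\<^bsub>grp n\<^esub> transl i (- b)"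
      using g i by (intro grp.inv_equality) (simp_all add: grp.m_assoc)
    also have "\<dots> = transl i e \<otimes>\<^bsub>grp n\<^esub> inv\<^bsub>grp n\<^esub> g"
      unfolding e_def by (rule conj_transl)
    finally have "transl i e \<otimes>\<^bsub>grp n\<^esub> inv\<^bsub>grp n\<^esub> g \<in> M"
      using M.m_inv_closed[OF b] by simp
    then show "inv\<^bsub>grp n\<^esub> g \<in> Y" using g by (auto simp: Y_def)
    fix h assume "h \<in> Y"
    then obtain d where h: "h \<in> carrier (grp n)" and d: "transl i d \<otimes>\<^bsub>grp n\<^esub> h \<in> M"
      by (auto simp: Y_def)
    define e where "e = lin (g i) * tw (cj (g i)) d"
    have "(transl i b \<otimes>\<^bsub>grp n\<^esub> g) \<otimes>\<^bsub>grp n\<^esub> (transl i d \<otimes>\<^bsub>grp n\<^esub> h)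
        = transl i b \<otimes>\<^bsub>grp n\<^esub> (g \<otimes>\<^bsub>grp n\<^esub> transl i d) \<otimes>\<^bsub>grp n\<^esub> h"
      using g h i by (simp add: grp.m_assoc)
    also have "\<dots> = transl i b \<otimes>\<^bsub>grp n\<^esub> (transl i e \<otimes>\<^bsub>grp n\<^esub> g) \<otimes>\<^bsub>grp n\<^esub> h"
      unfolding e_def conj_transl ..
    also have "\<dots> = (transl i b \<otimes>\<^bsub>grp n\<^esub> transl i e) \<otimes>\<^bsub>grp n\<^esub> (g \<otimes>\<^bsub>grp n\<^esub> h)"
      using g h i by (simp add: grp.m_assoc)
    also have "\<dots> = transl i (b + e) \<otimes>\<^bsub>grp n\<^esub> (g \<otimes>\<^bsub>grp n\<^esub> h)" by (simp add: transl_mult)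
    finally have "transl i (b + e) \<otimes>\<^bsub>grp n\<^esub> (g \<otimes>\<^bsub>grp n\<^esub> h) \<in> M"
      using M.m_closed[OF b d] by simp
    then show "g \<otimes>\<^bsub>grp n\<^esub> h \<in> Y" using g h by (auto simp: Y_def)
  qed (auto simp: Y_def)
  moreover have "M \<subseteq> Y"
    using M.subset zero unfolding Y_def by (metis (mono_tags, lifting) mem_Collect_eq subsetI subsetD)
  moreover have "transl i b \<in> Y"
    using i M.one_closed unfolding Y_def
    by (auto intro!: exI[of _ "- b"] simp: transl_mult zero')
  ultimately have Y: "Y = carrier (grp n)"
    using grp.maximal_subgroup_eqI[OF M _ _ _ b] by blast
  have supplement: "\<exists>e. transl i e \<otimes>\<^bsub>grp n\<^esub> g \<in> M" if "g \<in> carrier (grp n)" for g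
    using that Y by (auto simp: Y_def)
  have trivial: "d = 0" if d: "transl i d \<in> M" for d
  proof (rule ccontr)
    assume "d \<noteq> 0"
    have "transl i b \<in> M"
    proof (rule all_translations[OF M.is_subgroup i d \<open>d \<noteq> 0\<close>])
      fix u :: F9 assume u: "u \<noteq> 0"
      obtain e where "transl i e \<otimes>\<^bsub>grp n\<^esub> diagonal n (Aff u False 0) \<in> M"
        using supplement[OF diagonal_in_grp] u by (metis aff.sel(1))
      then show "\<exists>g\<in>M. lin (g i) = u \<and> \<not> cj (g i)"
        by (rule bexI[rotated]) (use i in \<open>simp add: diagonal_def transl_def single_def tw_def\<close>)
    qed
    with b show False by simp
  qed
  have "single i (Aff (- 1) False 0) \<in> carrier (grp n)" using i by (simp add: single_in_grp)
  from supplement[OF this] obtain e where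
    "transl i e \<otimes>\<^bsub>grp n\<^esub> single i (Aff (- 1) False 0) \<in> M" by blast
  moreover have "transl i e \<otimes>\<^bsub>grp n\<^esub> single i (Aff (- 1) False 0) = single i (Aff (- 1) False e)"
    by (rule grp_eqI) (simp add: transl_def single_def tw_def)
  ultimately have r: "single i (Aff (- 1) False e) \<in> M" by simp
  have "M \<subseteq> stab n i (- e)"
  proof
    fix x assume x: "x \<in> M"
    \<comment> \<open>Conjugation by \<open>x\<close> moves the centre of the reflection to \<open>act (x i) (- e)\<close>; the product of two
      reflections translates by twice the difference of the centres, and 2 is -1 here.\<close>
    define d where "d = - act (x i) (- e) - e"
    have "x \<otimes>\<^bsub>grp n\<^esub> single i (Aff (- 1) False e) = transl i d \<otimes>\<^bsub>grp n\<^esub> (single i (Aff (- 1) False e) \<otimes>\<^bsub>grp n\<^esub> x)"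
    proof (rule grp_eqI)
      fix j
      obtain u s b where x: "x j = Aff u s b" by (cases "x j")
      have "b = - b - b" for b :: F9 using char3[of b] by (simp add: algebra_simps)
      with x
      show "(x \<otimes>\<^bsub>grp n\<^esub> single i (Aff (- 1) False e)) j
          = (transl i d \<otimes>\<^bsub>grp n\<^esub> (single i (Aff (- 1) False e) \<otimes>\<^bsub>grp n\<^esub> x)) j"
        by (auto simp: transl_def single_def tw_def d_def)
    qed
    moreover have rx: "single i (Aff (- 1) False e) \<otimes>\<^bsub>grp n\<^esub> x \<in> M"
      "x \<otimes>\<^bsub>grp n\<^esub> single i (Aff (- 1) False e) \<in> M" using r x by blast+
    ultimately have "transl i d = x \<otimes>\<^bsub>grp n\<^esub> single i (Aff (- 1) False e) \<otimes>\<^bsub>grp n\<^esub>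
        inv\<^bsub>grp n\<^esub> (single i (Aff (- 1) False e) \<otimes>\<^bsub>grp n\<^esub> x)"
      using i M.mem_carrier by (subst grp.inv_solve_right) auto
    then have "transl i d \<in> M" using rx M.m_closed M.m_inv_closed by simp
    then have "d = 0" by (rule trivial)
    then have "act (x i) (- e) = - e"
      by (simp add: d_def minus_equation_iff[of "act (x i) (- e)" e])
    then show "x \<in> stab n i (- e)" using x M.mem_carrier
      by (simp add: stab_def)
  qed
  moreover have "stab n i (- e) \<noteq> carrier (grp n)"
    using maximal_stab[OF i] by (simp add: maximal_subgroup_def)
  ultimately have "M = stab n i (- e)"
    using M subgroup_stab unfolding maximal_subgroup_def by metis
  then show ?thesis ..
qed

section \<open>Maximal subgroups that contain all translations\<close>

lemma subgroup_core: "subgroup (core n) (grp n)"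
proof (rule grp.subgroupI)
  show "core n \<noteq> {}" using grp.one_closed[of n] by (auto simp: core_def)
  fix g assume g: "g \<in> core n"
  then show "inv\<^bsub>grp n\<^esub> g \<in> core n" by (auto simp: core_def grp_lin_nonzero)
  fix h assume "h \<in> core n"
  then show "g \<otimes>\<^bsub>grp n\<^esub> h \<in> core n" using g by (simp add: core_def)
qed (auto simp: core_def)

lemma single_same [simp]: "single i x i = x"
  by (simp add: single_def)

lemma single_mult: "single i x \<otimes>\<^bsub>grp n\<^esub> single i y = single i (x \<star> y)"
  by (rule grp_eqI) (simp add: single_def)

text \<open>The commutator stays in coordinate \<open>i\<close> whatever \<open>g\<close> does elsewhere, so \<open>g\<close> may have coordinates of
norm -1, although these occur only in all coordinates at once.\<close>

lemma single_commutator: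
  assumes "i < n" "nrm (lin x) = 1" "g \<in> carrier (grp n)"
  shows "single i x \<otimes>\<^bsub>grp n\<^esub> g \<otimes>\<^bsub>grp n\<^esub> inv\<^bsub>grp n\<^esub> (single i x) \<otimes>\<^bsub>grp n\<^esub> inv\<^bsub>grp n\<^esub> g
       = single i (x \<star> g i \<star> ainv x \<star> ainv (g i))"
proof (rule grp_eqI)
  fix j
  have "ainv aone = aone" by (simp add: aone_def tw_def)
  then show "(single i x \<otimes>\<^bsub>grp n\<^esub> g \<otimes>\<^bsub>grp n\<^esub> inv\<^bsub>grp n\<^esub> (single i x) \<otimes>\<^bsub>grp n\<^esub> inv\<^bsub>grp n\<^esub> g) j
       = single i (x \<star> g i \<star> ainv x \<star> ainv (g i)) j"
    using assms grp_lin_nonzero[OF assms(3)]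
    by (simp add: single_in_grp) (simp add: single_def amult_ainv)
qed

context
  fixes n :: nat and M
  assumes M: "maximal_subgroup M (grp n)"
    and transl: "\<And>i b. i < n \<Longrightarrow> transl i b \<in> M"
begin

text \<open>Climbing the upper central series of the 2-group of linear parts: multiplication by \<open>- 1\<close> is central
modulo translations, and it is the commutator of the Frobenius map and multiplication by \<open>iota\<close>.\<close>

lemma single_minus_one:
  assumes i: "i < n"
  shows "single i (Aff (- 1) False 0) \<in> M"
proof (rule grp.commutator_in_maximal_subgroup[OF M])
  show "single i (Aff 1 True 0) \<in> carrier (grp n)" "single i (Aff iota False 0) \<in> carrier (grp n)"
    using i by (auto intro!: single_in_grp)
  then show "single i (Aff (- 1) False 0) =
      single i (Aff 1 True 0) \<otimes>\<^bsub>grp n\<^esub> single i (Aff iota False 0) \<otimes>\<^bsub>grp n\<^esub>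
      inv\<^bsub>grp n\<^esub> (single i (Aff 1 True 0)) \<otimes>\<^bsub>grp n\<^esub> inv\<^bsub>grp n\<^esub> (single i (Aff iota False 0))"
    using i by (subst single_commutator) (simp_all add: tw_def)
  fix g assume g: "g \<in> carrier (grp n)"
  obtain u s b where u: "g i = Aff u s b" by (cases "g i")
  with grp_lin_nonzero[OF g, of i] have "u \<noteq> 0" by simp
  then have "Aff (- 1) False 0 \<star> g i \<star> ainv (Aff (- 1) False 0) \<star> ainv (g i)
      = Aff 1 False (tr (Aff (- 1) False 0 \<star> g i \<star> ainv (Aff (- 1) False 0) \<star> ainv (g i)))"
    unfolding u by (simp add: tw_def)
  then have "single i (Aff (- 1) False 0) \<otimes>\<^bsub>grp n\<^esub> g \<otimes>\<^bsub>grp n\<^esub>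
      inv\<^bsub>grp n\<^esub> (single i (Aff (- 1) False 0)) \<otimes>\<^bsub>grp n\<^esub> inv\<^bsub>grp n\<^esub> g
      = transl i (tr (Aff (- 1) False 0 \<star> g i \<star> ainv (Aff (- 1) False 0) \<star> ainv (g i)))"
    using i g by (subst single_commutator) (simp_all add: transl_def)
  then show "single i (Aff (- 1) False 0) \<otimes>\<^bsub>grp n\<^esub> g \<otimes>\<^bsub>grp n\<^esub>
      inv\<^bsub>grp n\<^esub> (single i (Aff (- 1) False 0)) \<otimes>\<^bsub>grp n\<^esub> inv\<^bsub>grp n\<^esub> g \<in> M"
    using transl[OF i] by simp
qed

lemma single_with_translation:
  assumes "i < n" "single i (Aff u False 0) \<in> M"
  shows "single i (Aff u False b) \<in> M"
proof -
  interpret M: subgroup M "grp n" using M by (simp add: maximal_subgroup_def)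
  have "single i (Aff u False b) = transl i b \<otimes>\<^bsub>grp n\<^esub> single i (Aff u False 0)"
    unfolding transl_def single_mult by (simp add: tw_def)
  then show ?thesis using M.m_closed[OF transl assms(2)] assms(1) by simp
qed

text \<open>The next step: multiplication by \<open>- iota\<close> is central modulo translations and \<open>- 1\<close>, and it is the
commutator of the Frobenius map in coordinate \<open>i\<close> with multiplication by \<open>1 + iota\<close>, an element of
norm -1.\<close>

lemma single_minus_iota:
  assumes i: "i < n"
  shows "single i (Aff (- iota) False 0) \<in> M" (is "?c \<in> M")
proof (rule grp.commutator_in_maximal_subgroup[OF M])
  interpret M: subgroup M "grp n" using M by (simp add: maximal_subgroup_def)
  show p: "single i (Aff 1 True 0) \<in> carrier (grp n)" and q: "diagonal n (Aff (1 + iota) False 0) \<in> carrier (grp n)"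
    using i one_plus_iota by (auto intro!: single_in_grp diagonal_in_grp)
  have comm: "Aff 1 True 0 \<star> Aff (1 + iota) False 0 \<star> ainv (Aff 1 True 0) \<star> ainv (Aff (1 + iota) False 0)
      = Aff (- iota) False 0"
    using one_plus_iota by (simp add: tw_def)
  show "?c = single i (Aff 1 True 0) \<otimes>\<^bsub>grp n\<^esub> diagonal n (Aff (1 + iota) False 0) \<otimes>\<^bsub>grp n\<^esub>
      inv\<^bsub>grp n\<^esub> (single i (Aff 1 True 0)) \<otimes>\<^bsub>grp n\<^esub> inv\<^bsub>grp n\<^esub> (diagonal n (Aff (1 + iota) False 0))"
    using i comm by (subst single_commutator[OF _ _ q]) (simp_all add: diagonal_def)
  fix g assume g: "g \<in> carrier (grp n)"
  obtain u s b where u: "g i = Aff u s b" by (cases "g i")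
  with grp_lin_nonzero[OF g, of i] have "u \<noteq> 0" by simp
  define x where "x = Aff (- iota) False 0 \<star> g i \<star> ainv (Aff (- iota) False 0) \<star> ainv (g i)"
  have "lin x = - iota * tw s iota * (u * inverse u)" "\<not> cj x"
    unfolding x_def u by (simp_all add: tw_def)
  then have "lin x \<in> {1, - 1}" "\<not> cj x" using \<open>u \<noteq> 0\<close> by (auto simp: tw_def)
  then have "single i x \<in> M"
    by (cases x) (use transl[OF i] single_with_translation[OF i single_minus_one[OF i]] in \<open>auto simp: transl_def\<close>)
  then show "?c \<otimes>\<^bsub>grp n\<^esub> g \<otimes>\<^bsub>grp n\<^esub> inv\<^bsub>grp n\<^esub> ?c \<otimes>\<^bsub>grp n\<^esub> inv\<^bsub>grp n\<^esub> g \<in> M"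
    using i g unfolding x_def by (subst single_commutator) simp_all
qed

lemma single_core:
  assumes i: "i < n" and x: "nrm (lin x) = 1" "\<not> cj x"
  shows "single i x \<in> M"
proof -
  interpret M: subgroup M "grp n" using M by (simp add: maximal_subgroup_def)
  have "single i (Aff (- 1) False 0) \<otimes>\<^bsub>grp n\<^esub> single i (Aff (- iota) False 0) \<in> M"
    using single_minus_one single_minus_iota i by (intro M.m_closed)
  then have "single i (Aff iota False 0) \<in> M" by (simp add: single_mult tw_def)
  moreover have "single i (Aff 1 False 0) \<in> M" using transl[OF i] by (simp add: transl_def)
  ultimately have "single i (Aff (lin x) False 0) \<in> M"
    using nrm_eq_1_cases[OF x(1)] single_minus_one[OF i] single_minus_iota[OF i] by auto
  from single_with_translation[OF i this, of "tr x"] x(2) show ?thesis by (cases x) simp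
qed

lemma core_le_maximal: "core n \<subseteq> M"
proof
  interpret M: subgroup M "grp n" using M by (simp add: maximal_subgroup_def)
  fix g assume g: "g \<in> core n"
  have "(\<lambda>j. if j < m then g j else aone) \<in> M" if "m \<le> n" for m
    using that
  proof (induction m)
    case 0
    have "(\<lambda>j. if j < 0 then g j else aone) = \<one>\<^bsub>grp n\<^esub>" by (rule grp_eqI) simp
    then show ?case using M.one_closed by simp
  next
    case (Suc m)
    have "(\<lambda>j. if j < Suc m then g j else aone) =
        (\<lambda>j. if j < m then g j else aone) \<otimes>\<^bsub>grp n\<^esub> single m (g m)"
      by (rule grp_eqI) (auto simp: single_def less_Suc_eq)
    moreover have "single m (g m) \<in> M" using Suc.prems g by (intro single_core) (auto simp: core_def)
    ultimately show ?case using Suc M.m_closed by simp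
  qed
  from this[of n] have "(\<lambda>j. if j < n then g j else aone) \<in> M" by simp
  moreover have "(\<lambda>j. if j < n then g j else aone) = g"
    by (rule grp_eqI) (use g in \<open>auto simp: core_def grp_def\<close>)
  ultimately show "g \<in> M" by simp
qed

text \<open>Modulo \<open>core n\<close> an element is determined by the norms and the Frobenius flags of its coordinates;
the quotient is an elementary abelian 2-group.\<close>

lemma same_type_in_maximal:
  assumes g: "g \<in> M" and h: "h \<in> carrier (grp n)"
    and same: "\<And>i. i < n \<Longrightarrow> nrm (lin (h i)) = nrm (lin (g i))" "\<And>i. i < n \<Longrightarrow> cj (h i) = cj (g i)"
  shows "h \<in> M"
proof -
  interpret M: subgroup M "grp n" using M by (simp add: maximal_subgroup_def)
  have gG: "g \<in> carrier (grp n)" using g by simp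
  have "h \<otimes>\<^bsub>grp n\<^esub> inv\<^bsub>grp n\<^esub> g \<in> core n"
    using gG h same nrm_square[OF grp_lin_nonzero[OF gG]] by (simp add: core_def grp_lin_nonzero[OF gG])
  then have "h \<otimes>\<^bsub>grp n\<^esub> inv\<^bsub>grp n\<^esub> g \<otimes>\<^bsub>grp n\<^esub> g \<in> M" using core_le_maximal g by blast
  then show ?thesis using gG h by (simp add: grp.m_assoc)
qed

text \<open>As the quotient by \<open>core n\<close> has exponent 2, adjoining one element \<open>x\<close> to \<open>M\<close> adds only one coset,
and the result is already the whole group.\<close>

lemma maximal_index_2:
  assumes x: "x \<in> carrier (grp n)" "x \<notin> M" and y: "y \<in> carrier (grp n)" "y \<notin> M"
  shows "x \<otimes>\<^bsub>grp n\<^esub> y \<in> M"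
proof -
  interpret M: subgroup M "grp n" using M by (simp add: maximal_subgroup_def)
  note sq = nrm_square[OF grp_lin_nonzero[OF x(1)]]
  \<comment> \<open>the union of \<open>M\<close> and the coset of the inverse of \<open>x\<close>\<close>
  define Y where "Y = {g \<in> carrier (grp n). g \<in> M \<or> x \<otimes>\<^bsub>grp n\<^esub> g \<in> M}"
  have "subgroup Y (grp n)"
  proof (rule grp.subgroupI)
    show "Y \<noteq> {}" using M.one_closed M.mem_carrier unfolding Y_def by blast
    fix g assume g: "g \<in> Y"
    then have gG: "g \<in> carrier (grp n)" by (simp add: Y_def)
    show "inv\<^bsub>grp n\<^esub> g \<in> Y"
    proof (cases "g \<in> M")
      case False
      then have "x \<otimes>\<^bsub>grp n\<^esub> g \<in> M" using g by (simp add: Y_def)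
      then have "x \<otimes>\<^bsub>grp n\<^esub> inv\<^bsub>grp n\<^esub> g \<in> M"
        by (rule same_type_in_maximal) (use gG x in \<open>simp_all add: grp_lin_nonzero[OF gG]\<close>)
      then show ?thesis using gG by (simp add: Y_def)
    qed (use gG in \<open>simp add: Y_def\<close>)
    fix h assume h: "h \<in> Y"
    then have hG: "h \<in> carrier (grp n)" by (simp add: Y_def)
    consider "g \<in> M" "h \<in> M" | "g \<in> M" "x \<otimes>\<^bsub>grp n\<^esub> h \<in> M" | "x \<otimes>\<^bsub>grp n\<^esub> g \<in> M" "h \<in> M"
      | "x \<otimes>\<^bsub>grp n\<^esub> g \<in> M" "x \<otimes>\<^bsub>grp n\<^esub> h \<in> M"
      using g h by (auto simp: Y_def)
    then have "g \<otimes>\<^bsub>grp n\<^esub> h \<in> M \<or> x \<otimes>\<^bsub>grp n\<^esub> (g \<otimes>\<^bsub>grp n\<^esub> h) \<in> M"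
    proof cases
      case 1
      then show ?thesis by (intro disjI1 M.m_closed)
    next
      case 2
      then have "x \<otimes>\<^bsub>grp n\<^esub> (g \<otimes>\<^bsub>grp n\<^esub> h) \<in> M"
        by (intro same_type_in_maximal[OF M.m_closed[OF 2]])
          (use gG hG x in \<open>auto simp: mult_ac\<close>)
      then show ?thesis ..
    next
      case 3
      then have "x \<otimes>\<^bsub>grp n\<^esub> (g \<otimes>\<^bsub>grp n\<^esub> h) \<in> M"
        using M.m_closed[OF 3] gG hG x by (simp add: grp.m_assoc)
      then show ?thesis ..
    next
      case 4
      then have "g \<otimes>\<^bsub>grp n\<^esub> h \<in> M"
        by (intro same_type_in_maximal[OF M.m_closed[OF 4]])
          (use gG hG x sq in \<open>auto simp: mult_ac\<close>)
      then show ?thesis ..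
    qed
    then show "g \<otimes>\<^bsub>grp n\<^esub> h \<in> Y" using gG hG by (simp add: Y_def)
  qed (auto simp: Y_def)
  moreover have "M \<subseteq> Y" using M.mem_carrier by (auto simp: Y_def)
  moreover have "x \<in> Y"
  proof -
    have "x \<otimes>\<^bsub>grp n\<^esub> x \<in> M"
      by (rule same_type_in_maximal[OF M.one_closed]) (use x sq in auto)
    then show ?thesis using x by (simp add: Y_def)
  qed
  ultimately have "Y = carrier (grp n)"
    using grp.maximal_subgroup_eqI[OF M _ _ _ x(2)] by blast
  with y show ?thesis by (auto simp: Y_def)
qed

end

text \<open>The derived series descends through \<open>core n\<close>, which is linear, and the group of translations.\<close>

lemma solvable_grp: "solvable (grp n)"
proof -
  define V where "V = {g \<in> core n. \<forall>i<n. lin (g i) = 1}"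
  have V: "subgroup V (grp n)"
  proof (rule grp.subgroupI)
    have core_simps: "lin ((g \<otimes>\<^bsub>grp n\<^esub> h) i) = 1"
      if "lin (g i) = 1" "lin (h i) = 1" for g h i
      using that by (cases "g i"; cases "h i") (simp add: tw_def)
    show "V \<noteq> {}" using subgroup.one_closed[OF subgroup_core, of n] by (auto simp: V_def)
    fix g assume g: "g \<in> V"
    then have gG: "g \<in> carrier (grp n)" by (simp add: V_def core_def)
    have "lin (ainv (g i)) = 1" if "i < n" for i
      using g that by (cases "g i") (auto simp: V_def tw_def)
    then show "inv\<^bsub>grp n\<^esub> g \<in> V"
      using g gG subgroup.m_inv_closed[OF subgroup_core] by (simp add: V_def)
    fix h assume h: "h \<in> V"
    then show "g \<otimes>\<^bsub>grp n\<^esub> h \<in> V"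
      using g core_simps subgroup.m_closed[OF subgroup_core]
      by (simp add: V_def del: mult_grp)
  qed (auto simp: V_def core_def)
  have step: "derived (grp n) H \<subseteq> K"
    if K: "subgroup K (grp n)" and "\<And>g h. g \<in> H \<Longrightarrow> h \<in> H \<Longrightarrow>
      g \<otimes>\<^bsub>grp n\<^esub> h \<otimes>\<^bsub>grp n\<^esub> inv\<^bsub>grp n\<^esub> g \<otimes>\<^bsub>grp n\<^esub> inv\<^bsub>grp n\<^esub> h \<in> K" for H K
    unfolding derived_def using that by (intro grp.generate_subgroup_incl[OF _ K]) auto
  have 1: "derived (grp n) (carrier (grp n)) \<subseteq> core n"
  proof (rule step[OF subgroup_core])
    fix g h assume g: "g \<in> carrier (grp n)" and h: "h \<in> carrier (grp n)"
    have "nrm (lin (g i)) * nrm (lin (h i)) * nrm (lin (g i)) * nrm (lin (h i)) = 1" for i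
      using nrm_square[OF grp_lin_nonzero[OF g]] nrm_square[OF grp_lin_nonzero[OF h]]
      by (metis mult.assoc mult.commute mult_1)
    then show "g \<otimes>\<^bsub>grp n\<^esub> h \<otimes>\<^bsub>grp n\<^esub> inv\<^bsub>grp n\<^esub> g \<otimes>\<^bsub>grp n\<^esub> inv\<^bsub>grp n\<^esub> h \<in> core n"
      using g h grp_lin_nonzero by (auto simp: core_def)
  qed
  have 2: "derived (grp n) (core n) \<subseteq> V"
  proof (rule step[OF V])
    fix g h assume gh: "g \<in> core n" "h \<in> core n"
    then have G: "g \<in> carrier (grp n)" "h \<in> carrier (grp n)" by (auto simp: core_def)
    have "lin (g i \<star> h i \<star> ainv (g i) \<star> ainv (h i)) = 1" if "i < n" for i
    proof -
      have "\<not> cj (g i)" "\<not> cj (h i)" using gh that by (auto simp: core_def)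
      then show ?thesis using grp_lin_nonzero[OF G(1), of i] grp_lin_nonzero[OF G(2), of i]
        by (cases "g i"; cases "h i") (simp add: tw_def field_simps)
    qed
    moreover have "g \<otimes>\<^bsub>grp n\<^esub> h \<otimes>\<^bsub>grp n\<^esub> inv\<^bsub>grp n\<^esub> g \<otimes>\<^bsub>grp n\<^esub> inv\<^bsub>grp n\<^esub> h \<in> core n"
      using gh by (intro subgroup.m_closed[OF subgroup_core] subgroup.m_inv_closed[OF subgroup_core])
    ultimately show "g \<otimes>\<^bsub>grp n\<^esub> h \<otimes>\<^bsub>grp n\<^esub> inv\<^bsub>grp n\<^esub> g \<otimes>\<^bsub>grp n\<^esub> inv\<^bsub>grp n\<^esub> h \<in> V"
      using G by (simp add: V_def)
  qed
  have 3: "derived (grp n) V \<subseteq> {\<one>\<^bsub>grp n\<^esub>}"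
  proof (rule step[OF grp.triv_subgroup])
    fix g h assume gh: "g \<in> V" "h \<in> V"
    then have G: "g \<in> carrier (grp n)" "h \<in> carrier (grp n)" by (auto simp: V_def core_def)
    have "g i \<star> h i \<star> ainv (g i) \<star> ainv (h i) = aone" for i
    proof (cases "i < n")
      case True
      then have "lin (g i) = 1" "lin (h i) = 1" "\<not> cj (g i)" "\<not> cj (h i)"
        using gh by (auto simp: V_def core_def)
      then show ?thesis by (cases "g i"; cases "h i") (simp add: tw_def aone_def)
    next
      case False
      then have "g i = aone" "h i = aone" using G by (auto simp: grp_def)
      then show ?thesis by (simp add: aone_def tw_def)
    qed
    then have "g \<otimes>\<^bsub>grp n\<^esub> h \<otimes>\<^bsub>grp n\<^esub> inv\<^bsub>grp n\<^esub> g \<otimes>\<^bsub>grp n\<^esub> inv\<^bsub>grp n\<^esub> h = \<one>\<^bsub>grp n\<^esub>"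
      using G by (intro grp_eqI) simp
    then show "g \<otimes>\<^bsub>grp n\<^esub> h \<otimes>\<^bsub>grp n\<^esub> inv\<^bsub>grp n\<^esub> g \<otimes>\<^bsub>grp n\<^esub> inv\<^bsub>grp n\<^esub> h \<in> {\<one>\<^bsub>grp n\<^esub>}" by simp
  qed
  have "(derived (grp n) ^^ 3) (carrier (grp n)) \<subseteq> {\<one>\<^bsub>grp n\<^esub>}"
    using 3 grp.mono_derived[OF 2] grp.mono_derived[OF grp.mono_derived[OF 1]]
    by (simp add: numeral_3_eq_3) blast
  moreover have "\<one>\<^bsub>grp n\<^esub> \<in> (derived (grp n) ^^ 3) (carrier (grp n))"
    by (rule subgroup.one_closed[OF grp.exp_of_derived_is_subgroup[OF grp.subgroup_self]])
  ultimately show ?thesis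
    using grp.solvable_iff_trivial_derived_seq by blast
qed

section \<open>The lower bound for alpha\<close>

text \<open>Taking norms in \<open>u * (z - w) = z - w\<close>, possibly with a Frobenius map on the left, which does not
change norms.\<close>

lemma fixes_two_points:
  assumes "act x z = z" "act x w = w" "z \<noteq> w"
  shows "nrm (lin x) = 1"
proof -
  obtain u s b where x: "x = Aff u s b" by (cases x)
  have "u * tw s (z - w) = act x z - act x w"
    by (simp add: x tw_def algebra_simps frob_diff)
  then have "u * tw s (z - w) = z - w" using assms by simp
  then have "nrm u * nrm (z - w) = nrm (z - w)" by (metis nrm_mult nrm_tw)
  then show ?thesis using assms(3) by (simp add: x)
qed

text \<open>The Frobenius map fixes 0 and 1; affine maps carry these to any two points.\<close>

lemma ex_reflection:
  assumes "z \<noteq> w"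
  obtains x where "act x z = z" "act x w = w" "x \<noteq> aone" "nrm (lin x) = 1"
proof
  define u where "u = (z - w) * inverse (frob (z - w))"
  have u: "u * frob (z - w) = z - w" using assms unfolding u_def by simp
  let ?x = "Aff u True (z - u * frob z)"
  show z: "act ?x z = z" by (simp add: tw_def)
  show w: "act ?x w = w" using u by (simp add: tw_def frob_diff algebra_simps)
  show "?x \<noteq> aone" by (simp add: aone_def)
  from fixes_two_points[OF z w assms] show "nrm (lin ?x) = 1" .
qed

lemma transl_in_stab_iff: "i < n \<Longrightarrow> transl i b \<in> stab n j z \<longleftrightarrow> i \<noteq> j \<or> b = 0"
  by (auto simp: stab_def act_transl)

lemma one_in_maximal: "M \<in> maximal_subgroups (grp n) \<Longrightarrow> \<one>\<^bsub>grp n\<^esub> \<in> M"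
  by (simp add: maximal_subgroups_def maximal_subgroup_def subgroup.one_closed)

lemma maximal_cases:
  assumes "M \<in> maximal_subgroups (grp n)"
  obtains (stab) i z where "i < n" "M = stab n i z"
  | (transl) "\<And>i b. i < n \<Longrightarrow> transl i b \<in> M"
  using assms maximal_missing_translation unfolding maximal_subgroups_def by blast

lemma frattini_grp: "frattini (grp n) = {\<one>\<^bsub>grp n\<^esub>}"
proof
  show "{\<one>\<^bsub>grp n\<^esub>} \<subseteq> frattini (grp n)"
    using one_in_maximal by (auto simp: frattini_def inter_in_def)
  show "frattini (grp n) \<subseteq> {\<one>\<^bsub>grp n\<^esub>}"
  proof
    fix g assume g: "g \<in> frattini (grp n)"
    then have gG: "g \<in> carrier (grp n)" by (simp add: frattini_def inter_in_def)
    have fixed: "act (g i) z = z" if "i < n" for i z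
    proof -
      have "stab n i z \<in> maximal_subgroups (grp n)"
        using that by (simp add: maximal_subgroups_def maximal_stab)
      then show ?thesis using g by (auto simp: frattini_def inter_in_def stab_def)
    qed
    have "g i = aone" for i
    proof (cases "i < n")
      case True
      obtain u s b where x: "g i = Aff u s b" by (cases "g i")
      have "b = 0" using fixed[OF True, of 0] by (simp add: x)
      moreover have "u = 1" using fixed[OF True, of 1] \<open>b = 0\<close> by (simp add: x)
      moreover have "\<not> s"
        using fixed[OF True, of iota] \<open>b = 0\<close> \<open>u = 1\<close> minus_iota_neq_iota by (auto simp: x tw_def)
      ultimately show ?thesis by (simp add: x aone_def)
    next
      case False
      then show ?thesis using gG by (auto simp: grp_def)
    qed
    then show "g \<in> {\<one>\<^bsub>grp n\<^esub>}" by (auto intro: grp_eqI)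
  qed
qed

text \<open>Here \<open>S i\<close> collects the point stabilisers in coordinate \<open>i\<close>, \<open>W\<close> the members of index 2, and \<open>I\<close> the
coordinates with exactly two point stabilisers. For \<open>J \<subseteq> I\<close> the element \<open>el J\<close> has in each coordinate
in \<open>J\<close> the involution that fixes the two points, so it lies in all point stabilisers of the family.
If \<open>el J\<close> and \<open>el K\<close> lay in the same members of \<open>W\<close>, their product would lie in every member; so
\<open>W\<close> has at least as many subsets as \<open>I\<close>.\<close>

lemma card_ge_3n:
  assumes T: "T \<subseteq> maximal_subgroups (grp n)" and triv: "inter_in (grp n) T = {\<one>\<^bsub>grp n\<^esub>}"
  shows "3 * n \<le> card T"
proof -
  define S where "S i = {M \<in> T. \<exists>z. M = stab n i z}" for i
  define W where "W = {M \<in> T. \<forall>i<n. \<forall>b. transl i b \<in> M}"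
  have finT: "finite T"
    using T finite_maximal_subgroups[OF finite_grp] by (rule finite_subset)
  have finS: "finite (S i)" and finW: "finite W" for i
    using finT by (simp_all add: S_def W_def)
  have trivI: "g = \<one>\<^bsub>grp n\<^esub>" if "g \<in> carrier (grp n)" "\<And>M. M \<in> T \<Longrightarrow> g \<in> M" for g
    using triv that unfolding inter_in_def by blast
  have T_cases: "(\<exists>j<n. M \<in> S j) \<or> M \<in> W" if "M \<in> T" for M
    using that T by (auto simp: S_def W_def elim!: maximal_cases[OF subsetD])
  have W_maximal: "maximal_subgroup M (grp n)" "\<And>i b. i < n \<Longrightarrow> transl i b \<in> M" if "M \<in> W" for M
    using that T by (auto simp: W_def maximal_subgroups_def)
  have ge2: "2 \<le> card (S i)" if i: "i < n" for i
  proof (rule ccontr)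
    assume "\<not> 2 \<le> card (S i)"
    then have "card (S i) = 0 \<or> card (S i) = 1" by auto
    then obtain A where "S i \<subseteq> {A}"
      using finS[of i] by (auto simp: card_1_singleton_iff)
    then have "\<exists>z. S i \<subseteq> {stab n i z}"
      by (cases "A \<in> S i") (auto simp: S_def)
    then obtain z where z: "S i \<subseteq> {stab n i z}" ..
    \<comment> \<open>the point reflection about \<open>z\<close>\<close>
    define r where "r = Aff (- 1) False (z + z)"
    have rG: "single i r \<in> carrier (grp n)" using i by (simp add: single_in_grp r_def)
    have "single i r \<in> M" if M: "M \<in> T" for M
      using T_cases[OF M]
    proof
      assume "\<exists>j<n. M \<in> S j"
      then obtain j w where j: "j < n" "M \<in> S j" "M = stab n j w" by (auto simp: S_def)
      show ?thesis
      proof (cases "j = i")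
        case True
        then have "M = stab n i z" using z j by blast
        then show ?thesis using rG by (simp add: stab_def r_def tw_def)
      next
        case False
        then show ?thesis using rG j by (simp add: stab_def single_def)
      qed
    next
      assume "M \<in> W"
      from single_core[OF W_maximal[OF this] i] show ?thesis by (simp add: r_def)
    qed
    from fun_cong[OF trivI[OF rG this], of i] show False
      using minus_one_neq_one by (simp add: r_def aone_def)
  qed
  define I where "I = {i. i < n \<and> card (S i) = 2}"
  have finI: "finite I" by (simp add: I_def)
  have "\<exists>x. x \<noteq> aone \<and> nrm (lin x) = 1 \<and> (\<forall>z. stab n i z \<in> S i \<longrightarrow> act x z = z)" if i: "i \<in> I" for i
  proof -
    obtain A B where AB: "S i = {A, B}" "A \<noteq> B" using i by (auto simp: I_def card_2_iff)
    then have "A \<in> S i" "B \<in> S i" by simp_all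
    then obtain z w where zw: "A = stab n i z" "B = stab n i w" unfolding S_def by blast
    \<comment> \<open>A point is determined by its stabiliser, which contains the point reflection about it.\<close>
    have eq: "v = v'" if "stab n i v = stab n i v'" for v v'
    proof (rule ccontr)
      assume "v \<noteq> v'"
      have "diagonal n (Aff (- 1) False (v + v)) \<in> stab n i v"
        using i by (simp add: stab_def diagonal_in_grp) (simp add: I_def diagonal_def tw_def)
      then have "diagonal n (Aff (- 1) False (v + v)) \<in> stab n i v'" using that by simp
      then have "v + v = v' + v'" using i
        by (simp add: stab_def I_def diagonal_def tw_def eq_diff_eq[symmetric] algebra_simps)
      with \<open>v \<noteq> v'\<close> show False by (simp add: char3)
    qed
    from AB zw have "z \<noteq> w" by blast
    then obtain x where x: "act x z = z" "act x w = w" "x \<noteq> aone" "nrm (lin x) = 1"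
      by (rule ex_reflection)
    have "act x v = v" if "stab n i v \<in> S i" for v
    proof -
      have "stab n i v = stab n i z \<or> stab n i v = stab n i w"
        using that unfolding AB(1) zw by simp
      then have "v = z \<or> v = w" using eq by metis
      then show ?thesis using x by auto
    qed
    then show ?thesis using x by (intro exI[of _ x]) simp
  qed
  then obtain a where "\<forall>i\<in>I. a i \<noteq> aone \<and> nrm (lin (a i)) = 1 \<and>
      (\<forall>z. stab n i z \<in> S i \<longrightarrow> act (a i) z = z)"
    using bchoice[of I "\<lambda>i x. x \<noteq> aone \<and> nrm (lin x) = 1 \<and> (\<forall>z. stab n i z \<in> S i \<longrightarrow> act x z = z)"]
    by auto
  then have a: "\<And>i. i \<in> I \<Longrightarrow> a i \<noteq> aone" "\<And>i. i \<in> I \<Longrightarrow> nrm (lin (a i)) = 1"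
    "\<And>i z. i \<in> I \<Longrightarrow> stab n i z \<in> S i \<Longrightarrow> act (a i) z = z" by simp_all
  define el where "el J = (\<lambda>j. if j \<in> J then a j else aone)" for J
  have elG: "el J \<in> carrier (grp n)" if "J \<subseteq> I" for J
  proof (rule grpI[of _ _ 1])
    show "nrm (lin (el J i)) = 1" for i
      using a(2)[of i] that by (auto simp: el_def)
    show "el J i = aone" if "n \<le> i" for i
    proof -
      have "i \<notin> I" using that by (simp add: I_def)
      then show ?thesis using \<open>J \<subseteq> I\<close> by (auto simp: el_def)
    qed
  qed simp
  have el_stab: "el J \<in> M" if J: "J \<subseteq> I" and j: "j < n" "M \<in> S j" for J j M
  proof -
    obtain z where z: "M = stab n j z" using j(2) by (auto simp: S_def)
    have "act (el J j) z = z"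
      using a(3)[of j z] J j z by (auto simp: el_def)
    then show ?thesis using elG[OF J] by (simp add: z stab_def)
  qed
  have "inj_on (\<lambda>J. {M \<in> W. el J \<in> M}) (Pow I)"
  proof (rule inj_onI, rule ccontr)
    fix J K assume JK: "J \<in> Pow I" "K \<in> Pow I" "J \<noteq> K"
      and eq: "{M \<in> W. el J \<in> M} = {M \<in> W. el K \<in> M}"
    then have G: "el J \<in> carrier (grp n)" "el K \<in> carrier (grp n)" using elG by auto
    have "el J \<otimes>\<^bsub>grp n\<^esub> el K \<in> M" if M: "M \<in> T" for M
    proof -
      have sub: "subgroup M (grp n)"
        using M T by (auto simp: maximal_subgroups_def maximal_subgroup_def)
      consider j where "j < n" "M \<in> S j" | "M \<in> W" using T_cases[OF M] by blast
      then show ?thesis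
      proof cases
        case 1
        then show ?thesis using el_stab JK by (intro subgroup.m_closed[OF sub]) auto
      next
        case 2
        then have iff: "el J \<in> M \<longleftrightarrow> el K \<in> M" using eq by blast
        show ?thesis
        proof (cases "el J \<in> M")
          case True
          then show ?thesis using iff by (intro subgroup.m_closed[OF sub]) auto
        next
          case False
          then show ?thesis using maximal_index_2[OF W_maximal[OF 2] G(1) False G(2)] iff by simp
        qed
      qed
    qed
    then have one: "el J \<otimes>\<^bsub>grp n\<^esub> el K = \<one>\<^bsub>grp n\<^esub>" using G by (intro trivI) auto
    from JK obtain j where "j \<in> I" "j \<in> J \<longleftrightarrow> j \<notin> K" by blast
    then have "(el J \<otimes>\<^bsub>grp n\<^esub> el K) j = a j" by (auto simp: el_def)
    with one a(1)[OF \<open>j \<in> I\<close>] show False by simp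
  qed
  then have "card (Pow I) \<le> card (Pow W)"
    using finW by (intro card_inj_on_le[of "\<lambda>J. {M \<in> W. el J \<in> M}"]) auto
  then have IW: "card I \<le> card W" using finI finW by (simp add: card_Pow)
  have disj: "S i \<inter> S j = {}" if "i < n" "j < n" "i \<noteq> j" for i j
  proof -
    have False if "stab n i z = stab n j w" for z w
      using transl_in_stab_iff[OF \<open>i < n\<close>, of 1 i z] transl_in_stab_iff[OF \<open>i < n\<close>, of 1 j w]
        that \<open>i \<noteq> j\<close> by simp
    then show ?thesis by (auto simp: S_def)
  qed
  have disjW: "(\<Union>i<n. S i) \<inter> W = {}"
  proof -
    have False if "i < n" "stab n i z \<in> W" for i z
      using transl_in_stab_iff[OF that(1), of 1 i z] that by (auto simp: W_def)
    then show ?thesis by (auto simp: S_def)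
  qed
  have "card (\<Union>i<n. S i) = (\<Sum>i<n. card (S i))"
    using disj finS by (intro card_UN_disjoint) auto
  also have "\<dots> \<ge> (\<Sum>i<n. 3 - (if i \<in> I then 1 else 0))"
  proof (rule sum_mono)
    fix i assume "i \<in> {..<n}"
    then show "3 - (if i \<in> I then 1 else 0) \<le> card (S i)"
      using ge2[of i] by (cases "card (S i) = 2") (auto simp: I_def)
  qed
  finally have "(\<Sum>i<n. 3 - (if i \<in> I then 1 else 0)) \<le> card (\<Union>i<n. S i)" .
  moreover have "(\<Sum>i<n. 3 - (if i \<in> I then 1 else 0)) + card I = 3 * n"
  proof -
    have "card I = (\<Sum>i<n. if i \<in> I then 1 else 0)"
      by (simp add: sum.If_cases I_def Int_def conj_commute)
    then have "(\<Sum>i<n. 3 - (if i \<in> I then 1 else 0)) + card I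
        = (\<Sum>i<n. 3 - (if i \<in> I then 1 else 0) + (if i \<in> I then 1 else 0))"
      by (simp only: sum.distrib)
    also have "\<dots> = (\<Sum>i<n. 3)" by (rule sum.cong) auto
    finally show ?thesis by simp
  qed
  moreover have "card (\<Union>i<n. S i) + card W = card ((\<Union>i<n. S i) \<union> W)"
    using disjW finS finW by (intro card_Un_disjoint[symmetric]) auto
  moreover have "card ((\<Union>i<n. S i) \<union> W) \<le> card T"
    using finT by (intro card_mono) (auto simp: S_def W_def)
  ultimately show ?thesis using IW by linarith
qed

lemma alpha_grp: "3 * n \<le> alpha (grp n)"
proof -
  have "\<exists>m. \<exists>T \<subseteq> maximal_subgroups (grp n). inter_in (grp n) T = frattini (grp n) \<and> card T = m"
    using ex_inter_frattini[of "grp n"] by auto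
  from LeastI_ex[OF this] obtain T where T: "T \<subseteq> maximal_subgroups (grp n)"
    "inter_in (grp n) T = frattini (grp n)" "card T = alpha (grp n)"
    unfolding alpha_def by auto
  show ?thesis using card_ge_3n[OF T(1) T(2)[unfolded frattini_grp]] T(3) by simp
qed

section \<open>A short maximal irredundant family\<close>

definition norm_one :: "nat \<Rightarrow> (nat \<Rightarrow> aff) set" where
  "norm_one n = {g \<in> carrier (grp n). \<forall>i<n. nrm (lin (g i)) = 1}"

definition linear_at :: "nat \<Rightarrow> nat \<Rightarrow> (nat \<Rightarrow> aff) set" where
  "linear_at n i = {g \<in> carrier (grp n). \<not> cj (g i)}"

lemma transl_in_norm_one_linear_at: "i < n \<Longrightarrow> transl i b \<in> norm_one n" "i < n \<Longrightarrow> transl i b \<in> linear_at n j"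
  by (simp_all add: norm_one_def linear_at_def, simp_all add: transl_def single_def)

lemma one_plus_iota_grp:
  "diagonal n (Aff (1 + iota) False 0) \<in> carrier (grp n)" "nrm (1 + iota) \<noteq> 1"
  using one_plus_iota nrm_one_plus_iota minus_one_neq_one by (simp_all add: diagonal_in_grp)

lemma frobenius_grp: "i < n \<Longrightarrow> single i (Aff 1 True 0) \<in> carrier (grp n)"
  by (simp add: single_in_grp)

lemma maximal_norm_one:
  assumes "n > 0"
  shows "maximal_subgroup (norm_one n) (grp n)"
proof (rule grp.maximal_subgroup_if_index_2)
  show "subgroup (norm_one n) (grp n)"
  proof (rule grp.subgroupI)
    show "norm_one n \<noteq> {}" using grp.one_closed[of n] by (auto simp: norm_one_def)
    fix g assume g: "g \<in> norm_one n"
    then show "inv\<^bsub>grp n\<^esub> g \<in> norm_one n" by (auto simp: norm_one_def grp_lin_nonzero)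
    fix h assume "h \<in> norm_one n"
    then show "g \<otimes>\<^bsub>grp n\<^esub> h \<in> norm_one n" using g by (simp add: norm_one_def)
  qed (auto simp: norm_one_def)
  have "diagonal n (Aff (1 + iota) False 0) \<notin> norm_one n"
    using one_plus_iota_grp(2) assms by (auto simp: norm_one_def diagonal_def)
  then show "norm_one n \<noteq> carrier (grp n)" using one_plus_iota_grp(1) by blast
  fix g h assume "g \<in> carrier (grp n) - norm_one n" "h \<in> carrier (grp n) - norm_one n"
  then obtain i j where g: "g \<in> carrier (grp n)" "i < n" "nrm (lin (g i)) \<noteq> 1"
    and h: "h \<in> carrier (grp n)" "j < n" "nrm (lin (h j)) \<noteq> 1"
    by (auto simp: norm_one_def)
  have "nrm (lin (g l)) = - 1" "nrm (lin (h l)) = - 1" if "l < n" for l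
    using grp_nrm_eq[OF g(1,2) that] grp_nrm_eq[OF h(1,2) that] g h
      nrm_cases[of "lin (g i)"] nrm_cases[of "lin (h j)"]
      grp_lin_nonzero[OF g(1), of i] grp_lin_nonzero[OF h(1), of j] by auto
  then show "g \<otimes>\<^bsub>grp n\<^esub> h \<in> norm_one n" using g h by (simp add: norm_one_def)
qed

lemma maximal_linear_at:
  assumes "i < n"
  shows "maximal_subgroup (linear_at n i) (grp n)"
proof (rule grp.maximal_subgroup_if_index_2)
  show "subgroup (linear_at n i) (grp n)"
  proof (rule grp.subgroupI)
    show "linear_at n i \<noteq> {}" using grp.one_closed[of n] by (auto simp: linear_at_def)
  qed (auto simp: linear_at_def)
  have "single i (Aff 1 True 0) \<notin> linear_at n i" by (simp add: linear_at_def)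
  then show "linear_at n i \<noteq> carrier (grp n)"
    using frobenius_grp[OF assms] by blast
qed (auto simp: linear_at_def)

text \<open>The intersection of this family is not the Frattini subgroup; what makes the family maximal is that
\<open>norm_one n\<close> guards against all point stabilisers at once, for every coordinate.\<close>

definition short_family :: "nat \<Rightarrow> (nat \<Rightarrow> aff) set set" where
  "short_family n = insert (norm_one n) ((\<lambda>i. stab n i 0) ` {..<n} \<union> linear_at n ` {..<n})"

lemma card_short: "card (short_family n) \<le> 2 * n + 1"
proof -
  have "card ((\<lambda>i. stab n i 0) ` {..<n} \<union> linear_at n ` {..<n}) \<le> n + n"
    using card_Un_le[of "(\<lambda>i. stab n i 0) ` {..<n}" "linear_at n ` {..<n}"]
      card_image_le[of "{..<n}" "\<lambda>i. stab n i 0"] card_image_le[of "{..<n}" "linear_at n"]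
    by simp
  then show ?thesis
    using card_insert_le_m1[of "2 * n + 1" "(\<lambda>i. stab n i 0) ` {..<n} \<union> linear_at n ` {..<n}" "norm_one n"]
    by (simp add: short_family_def)
qed

lemma inter_short: "\<Inter> (short_family n) \<subseteq> core n"
  by (auto simp: short_family_def core_def norm_one_def linear_at_def)

text \<open>Irredundancy is witnessed by multiplication by \<open>1 + iota\<close> in all coordinates for \<open>norm_one n\<close>, a
translation for a point stabiliser, and the Frobenius map in one coordinate for \<open>linear_at n i\<close>.
The number \<open>n\<close> must be positive for \<open>norm_one n\<close> to be a proper subgroup.\<close>

lemma maximal_irredundant_short:
  assumes n: "n > 0"
  shows "maximal_irredundant (grp n) (short_family n)"
  unfolding maximal_irredundant_def
proof (intro conjI allI impI)
  show "irredundant (grp n) (short_family n)"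
  proof (rule irredundantI)
    show "short_family n \<subseteq> maximal_subgroups (grp n)"
      using maximal_norm_one[OF n] maximal_linear_at maximal_stab by (auto simp: short_family_def maximal_subgroups_def)
    fix A assume "A \<in> short_family n"
    then consider "A = norm_one n" | i where "i < n" "A = stab n i 0" | i where "i < n" "A = linear_at n i"
      by (auto simp: short_family_def)
    then show "\<exists>g\<in>carrier (grp n). g \<notin> A \<and> (\<forall>B\<in>short_family n. B \<noteq> A \<longrightarrow> g \<in> B)"
    proof cases
      case 1
      then show ?thesis using one_plus_iota_grp(1)[of n] one_plus_iota_grp(2) n
        by (intro bexI[of _ "diagonal n (Aff (1 + iota) False 0)"])
          (auto simp: short_family_def norm_one_def linear_at_def stab_def diagonal_def tw_def)
    next
      case 2
      have "transl i 1 \<in> B" if B: "B \<in> short_family n" "B \<noteq> A" for B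
      proof -
        consider "B = norm_one n" | j where "j < n" "B = stab n j 0" "j \<noteq> i" | j where "B = linear_at n j"
          using B 2 by (auto simp: short_family_def)
        then show ?thesis using 2
          by cases (auto simp: transl_in_stab_iff transl_in_norm_one_linear_at)
      qed
      then show ?thesis using 2 by (intro bexI[of _ "transl i 1"]) (auto simp: transl_in_stab_iff)
    next
      case 3
      have "single i (Aff 1 True 0) \<in> B" if B: "B \<in> short_family n" "B \<noteq> A" for B
      proof -
        consider "B = norm_one n" | j where "j < n" "B = stab n j 0" | j where "B = linear_at n j" "j \<noteq> i"
          using B 3 by (auto simp: short_family_def)
        then show ?thesis using frobenius_grp[OF 3(1)]
          by cases (auto simp: norm_one_def linear_at_def stab_def single_def tw_def)
      qed
      then show ?thesis using 3 frobenius_grp[OF 3(1)]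
        by (intro bexI[of _ "single i (Aff 1 True 0)"]) (auto simp: linear_at_def)
    qed
  qed
  fix T assume T: "irredundant (grp n) T"
  show "\<not> short_family n \<subset> T"
  proof
    assume "short_family n \<subset> T"
    then obtain M where M: "M \<in> T" "M \<notin> short_family n" and sub: "short_family n \<subseteq> T" by blast
    have "M \<in> maximal_subgroups (grp n)" using M T by (auto simp: irredundant_def)
    then show False
    proof (cases rule: maximal_cases)
      case (stab i z)
      then have "z \<noteq> 0" using M by (auto simp: short_family_def)
      have "norm_one n \<in> T" using sub by (auto simp: short_family_def)
      moreover have "M \<in> T - {norm_one n}" using M by (auto simp: short_family_def)
      \<comment> \<open>\<open>stab n i 0\<close> must not be the very subgroup that is removed.\<close>
      moreover have "stab n i 0 \<in> T - {norm_one n}"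
      proof -
        have "transl i 1 \<in> norm_one n" using stab by (simp add: transl_in_norm_one_linear_at)
        moreover have "transl i 1 \<notin> stab n i 0" using stab by (simp add: transl_in_stab_iff)
        ultimately show ?thesis using sub stab by (auto simp: short_family_def)
      qed
      moreover have "M \<inter> stab n i 0 \<subseteq> norm_one n"
      proof
        fix g assume "g \<in> M \<inter> stab n i 0"
        then have g: "g \<in> carrier (grp n)" "act (g i) z = z" "act (g i) 0 = 0"
          using stab by (auto simp: stab_def)
        then have "nrm (lin (g i)) = 1" using \<open>z \<noteq> 0\<close> by (rule_tac fixes_two_points)
        then show "g \<in> norm_one n" using g grp_nrm_eq[OF g(1) stab(1)] by (auto simp: norm_one_def)
      qed
      ultimately have "\<not> irredundant (grp n) T" by (intro redundantI[of "norm_one n"]) auto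
      with T show False by simp
    next
      case transl
      have "maximal_subgroup M (grp n)" using M T by (auto simp: irredundant_def maximal_subgroups_def)
      from core_le_maximal[OF this transl] have "core n \<subseteq> M" .
      moreover have "\<Inter> (T - {M}) \<subseteq> \<Inter> (short_family n)" using sub M by blast
      ultimately have "\<Inter> (T - {M}) \<subseteq> M" using inter_short by (meson subset_trans)
      then have "\<not> irredundant (grp n) T" by (intro redundantI[OF M(1)] le_infI2)
      with T show False by simp
    qed
  qed
qed

section \<open>Invariance under isomorphism\<close>

lemma maximal_subgroup_iso:
  assumes G: "group G" and H: "group H" and h: "h \<in> iso G H" and M: "maximal_subgroup M G"
  shows "maximal_subgroup (h ` M) H"
  unfolding maximal_subgroup_def
proof (intro conjI allI impI)
  define k where "k = inv_into (carrier G) h"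
  have k: "k \<in> iso H G" unfolding k_def by (rule group.iso_set_sym[OF G h])
  have inj: "inj_on h (carrier G)" and surj: "h ` carrier G = carrier H"
    using h by (auto simp: iso_def bij_betw_def)
  have MG: "M \<subseteq> carrier G" and sub: "subgroup M G" and proper: "M \<noteq> carrier G"
    using M subgroup.subset by (auto simp: maximal_subgroup_def)
  show "subgroup (h ` M) H" by (rule subgroup.iso_subgroup[OF sub G H h])
  show "h ` M \<noteq> carrier H"
    using inj_on_image_eq_iff[OF inj MG order_refl] proper surj by auto
  fix K assume K: "subgroup K H \<and> h ` M \<subseteq> K"
  then have KH: "K \<subseteq> carrier H" by (auto dest: subgroup.subset)
  have "subgroup (k ` K) G" using subgroup.iso_subgroup[OF _ H G k] K by blast
  moreover have "M \<subseteq> k ` K"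
  proof
    fix x assume "x \<in> M"
    then have "h x \<in> K" "k (h x) = x" using K MG inj by (auto simp: k_def inv_into_f_f)
    then show "x \<in> k ` K" by (metis image_eqI)
  qed
  ultimately have "k ` K = M \<or> k ` K = carrier G" using M by (auto simp: maximal_subgroup_def)
  moreover have "h ` (k ` K) = K"
    unfolding k_def using KH surj by (intro image_inv_into_cancel) auto
  ultimately show "K = h ` M \<or> K = carrier H" using surj by auto
qed

lemma maximal_subgroups_subset: "maximal_subgroups G \<subseteq> Pow (carrier G)"
  using subgroup.subset by (auto simp: maximal_subgroups_def maximal_subgroup_def)

context
  fixes G :: "('a, 'c) monoid_scheme" and H :: "('b, 'd) monoid_scheme" and h
  assumes G: "group G" and H: "group H" and h: "h \<in> iso G H"
begin

lemma inj_h: "inj_on h (carrier G)" and surj_h: "h ` carrier G = carrier H"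
  using h by (auto simp: iso_def bij_betw_def)

lemma inv_image:
  assumes "B \<subseteq> carrier G"
  shows "inv_into (carrier G) h ` h ` B = B"
  using inj_h assms by (rule inv_into_image_cancel)

lemma image_inv:
  assumes "B \<subseteq> carrier H"
  shows "h ` inv_into (carrier G) h ` B = B"
  using surj_h assms by (rule image_inv_into_cancel)

lemma maximal_subgroups_iso: "maximal_subgroups H = (`) h ` maximal_subgroups G"
proof
  show "(`) h ` maximal_subgroups G \<subseteq> maximal_subgroups H"
    using maximal_subgroup_iso[OF G H h] by (auto simp: maximal_subgroups_def)
  show "maximal_subgroups H \<subseteq> (`) h ` maximal_subgroups G"
  proof
    fix M assume M: "M \<in> maximal_subgroups H"
    then have "M \<subseteq> carrier H"
      using subgroup.subset by (auto simp: maximal_subgroups_def maximal_subgroup_def)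
    then have "M = h ` (inv_into (carrier G) h ` M)" by (simp add: image_inv)
    moreover have "inv_into (carrier G) h ` M \<in> maximal_subgroups G"
      using maximal_subgroup_iso[OF H G group.iso_set_sym[OF G h]] M
      by (auto simp: maximal_subgroups_def)
    ultimately show "M \<in> (`) h ` maximal_subgroups G" by (rule image_eqI)
  qed
qed

lemma inter_in_iso:
  assumes "S \<subseteq> Pow (carrier G)"
  shows "inter_in H ((`) h ` S) = h ` inter_in G S"
proof
  show "h ` inter_in G S \<subseteq> inter_in H ((`) h ` S)"
    using surj_h by (auto simp: inter_in_def)
  show "inter_in H ((`) h ` S) \<subseteq> h ` inter_in G S"
  proof
    fix y assume y: "y \<in> inter_in H ((`) h ` S)"
    then obtain x where x: "x \<in> carrier G" "y = h x"
      using surj_h by (auto simp: inter_in_def)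
    have "x \<in> B" if "B \<in> S" for B
    proof -
      have "h x \<in> h ` B" using y that x by (auto simp: inter_in_def)
      then show ?thesis using inj_on_image_mem_iff[OF inj_h x(1)] that assms by blast
    qed
    then show "y \<in> h ` inter_in G S" using x by (auto simp: inter_in_def)
  qed
qed

lemma inter_in_iso_eq_iff:
  assumes "S \<subseteq> Pow (carrier G)" "T \<subseteq> Pow (carrier G)"
  shows "inter_in H ((`) h ` S) = inter_in H ((`) h ` T) \<longleftrightarrow> inter_in G S = inter_in G T"
  using inj_on_image_eq_iff[OF inj_h, of "inter_in G S" "inter_in G T"]
  by (simp add: inter_in_iso assms) (simp add: inter_in_def)

lemma card_iso:
  assumes "S \<subseteq> Pow (carrier G)"
  shows "card ((`) h ` S) = card S"
  using inj_on_subset[OF inj_on_image_Pow[OF inj_h] assms] by (rule card_image)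

lemma irredundant_iso:
  assumes "irredundant G S"
  shows "irredundant H ((`) h ` S)"
  unfolding irredundant_def
proof (intro conjI allI impI)
  have S: "S \<subseteq> maximal_subgroups G" using assms by (simp add: irredundant_def)
  then show "(`) h ` S \<subseteq> maximal_subgroups H" unfolding maximal_subgroups_iso by (rule image_mono)
  fix T' assume T': "T' \<subset> (`) h ` S"
  then obtain T where T: "T \<subseteq> S" "T' = (`) h ` T" by (meson psubset_imp_subset subset_imageE)
  then have "T \<subset> S" using T' by blast
  then have "inter_in G T \<noteq> inter_in G S" using assms by (simp add: irredundant_def)
  then show "inter_in H T' \<noteq> inter_in H ((`) h ` S)"
    using inter_in_iso_eq_iff[of T S] S T maximal_subgroups_subset by (metis subset_trans)
qed

lemma alpha_witness_iso:
  assumes "\<exists>T \<subseteq> maximal_subgroups G. inter_in G T = frattini G \<and> card T = m"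
  shows "\<exists>T \<subseteq> maximal_subgroups H. inter_in H T = frattini H \<and> card T = m"
proof -
  obtain T where T: "T \<subseteq> maximal_subgroups G" "inter_in G T = frattini G" "card T = m"
    using assms by blast
  have P: "T \<subseteq> Pow (carrier G)" using T(1) maximal_subgroups_subset by (rule subset_trans)
  show ?thesis
  proof (intro exI conjI)
    show "(`) h ` T \<subseteq> maximal_subgroups H"
      unfolding maximal_subgroups_iso using T(1) by (rule image_mono)
    show "inter_in H ((`) h ` T) = frattini H"
      using T(2) inter_in_iso_eq_iff[OF P maximal_subgroups_subset]
      by (simp add: frattini_def maximal_subgroups_iso)
    show "card ((`) h ` T) = m" using T(3) card_iso[OF P] by simp
  qed
qed

end

lemma maximal_irredundant_iso:
  assumes G: "group G" and H: "group H" and h: "h \<in> iso G H" and S: "maximal_irredundant G S"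
  shows "maximal_irredundant H ((`) h ` S)"
  unfolding maximal_irredundant_def
proof (intro conjI allI impI notI)
  define k where "k = inv_into (carrier G) h"
  have k: "k \<in> iso H G" unfolding k_def by (rule group.iso_set_sym[OF G h])
  have irr: "irredundant G S" using S by (simp add: maximal_irredundant_def)
  then show "irredundant H ((`) h ` S)" by (rule irredundant_iso[OF G H h])
  fix T assume T: "irredundant H T" and less: "(`) h ` S \<subset> T"
  have SG: "S \<subseteq> Pow (carrier G)" using irr maximal_subgroups_subset[of G] by (auto simp: irredundant_def)
  have TH: "T \<subseteq> Pow (carrier H)" using T maximal_subgroups_subset[of H] by (auto simp: irredundant_def)
  have "(`) k ` (`) h ` S = S"
  proof -
    have "k ` h ` B = B" if "B \<in> S" for B
      unfolding k_def using SG that by (intro inv_image[OF G H h]) blast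
    then have "(\<lambda>B. k ` h ` B) ` S = (\<lambda>B. B) ` S" by (rule image_cong[OF refl])
    then show ?thesis by (simp only: image_image[of "(`) k" "(`) h"]) simp
  qed
  moreover have "(`) k ` (`) h ` S \<subset> (`) k ` T"
    by (rule image_strict_mono[OF inj_on_subset[OF inj_on_image_Pow[OF inj_h[OF H G k]] TH] less])
  ultimately have "S \<subset> (`) k ` T" by simp
  moreover have "irredundant G ((`) k ` T)" by (rule irredundant_iso[OF H G k T])
  ultimately show False using S by (auto simp: maximal_irredundant_def)
qed

lemma alpha_iso:
  assumes "group G" "group H" "h \<in> iso G H"
  shows "alpha H = alpha G"
proof -
  have "(\<exists>T \<subseteq> maximal_subgroups H. inter_in H T = frattini H \<and> card T = m) \<longleftrightarrow>
      (\<exists>T \<subseteq> maximal_subgroups G. inter_in G T = frattini G \<and> card T = m)" for m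
    using alpha_witness_iso[OF assms] alpha_witness_iso[OF assms(2,1) group.iso_set_sym[OF assms(1,3)]]
    by blast
  then show ?thesis by (simp add: alpha_def)
qed

lemma Mindim_le: "maximal_irredundant G S \<Longrightarrow> Mindim G \<le> card S"
  unfolding Mindim_def by (rule Least_le) blast

lemma ex_nat_copy:
  fixes G :: "('a, 'b) monoid_scheme"
  assumes "group G" "finite (carrier G)"
  obtains H :: "nat monoid" and h where "group H" "h \<in> iso G H"
proof -
  obtain h :: "'a \<Rightarrow> nat" where inj: "inj_on h (carrier G)"
    using finite_imp_inj_to_nat_seg[OF assms(2)] by blast
  define k where "k = inv_into (carrier G) h"
  define H where "H = \<lparr>carrier = h ` carrier G, monoid.mult = (\<lambda>x y. h (k x \<otimes>\<^bsub>G\<^esub> k y)), one = h \<one>\<^bsub>G\<^esub>\<rparr>"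
  have kh: "k (h x) = x" if "x \<in> carrier G" for x using inj that by (simp add: k_def)
  have hom: "h \<in> hom G H"
    by (rule homI) (auto simp: H_def kh)
  interpret group G by (fact assms(1))
  have "group (H \<lparr>carrier := h ` carrier G, one := h \<one>\<^bsub>G\<^esub>\<rparr>)"
    by (rule hom_imp_img_group[OF hom])
  then have "group H" by (simp add: H_def)
  moreover have "h \<in> iso G H"
    using hom inj by (auto simp: iso_def bij_betw_def H_def)
  ultimately show thesis by (rule that)
qed

section \<open>The difference of the two invariants\<close>

theorem mainTheorem4:
  fixes k :: nat
  assumes "k > 0"
  shows "\<exists>G :: nat monoid.
           group G \<and> finite (carrier G) \<and> solvable G \<and>
           int (alpha G) - int (Mindim G) \<ge> int k"
proof -
  let ?n = "k + 1"
  obtain G :: "nat monoid" and h where G: "group G" and h: "h \<in> iso (grp ?n) G"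
    using ex_nat_copy[OF group_grp finite_grp] .
  have surj: "h ` carrier (grp ?n) = carrier G" using surj_h[OF group_grp G h] .
  have "group_hom (grp ?n) G h"
    using h G group_grp by (simp add: group_hom_def group_hom_axioms_def iso_def)
  then have "solvable G"
    using group_hom.surj_hom_imp_solvable surj solvable_grp by blast
  moreover have "finite (carrier G)"
    using finite_grp[of ?n] surj by (metis finite_imageI)
  moreover have "3 * ?n \<le> alpha G"
    using alpha_grp[of ?n] alpha_iso[OF group_grp G h] by simp
  moreover have "Mindim G \<le> 2 * ?n + 1"
  proof -
    have short: "maximal_irredundant (grp ?n) (short_family ?n)"
      by (rule maximal_irredundant_short) simp
    then have "short_family ?n \<subseteq> Pow (carrier (grp ?n))"
      using maximal_subgroups_subset[of "grp ?n"]
      by (auto simp: maximal_irredundant_def irredundant_def)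
    then have "card ((`) h ` short_family ?n) \<le> 2 * ?n + 1"
      using card_short[of ?n] card_iso[OF group_grp G h] by simp
    with Mindim_le[OF maximal_irredundant_iso[OF group_grp G h short]] show ?thesis by simp
  qed
  ultimately show ?thesis using G by (intro exI[of _ G]) auto
qed

end
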